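(* Let $\Gamma$ be a countably infinite discrete group. If $\Gamma$ has at most countably many infinite locally finite subgroups, then there exists a free $\Gamma$-flow that is $\Delta$-minimal with respect to every infinite subgroup $\Delta\leq\Gamma$ (a single flow that works simultaneously for all infinite subgroups $\Delta$).
   Context: A $\Gamma$-flow is a nonempty compact Hausdorff space $X$ equipped with a continuous action of $\Gamma$. It is free if $\gamma\cdot x\neq x$ for all $x\in X$ and all non-identity $\gamma\in\Gamma$. For a subset $S\subseteq\Gamma$, a $\Gamma$-flow $X$ is $S$-minimal if for every $x\in X$ the partial orbit $S\cdot x=\{\sigma\cdot x:\sigma\in S\}$ is dense in $X$. A group is locally finite if all of its finitely generated subgroups are finite. *)

theory Defs
  imports
    "HOL-Analysis.Analysis"
    "HOL-Algebra.Group_Action"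
    "HOL-Algebra.Generated_Groups"
begin

text \<open>Groups are discrete, so continuity of an action \<open>\<phi>\<close> is joint continuity of
  \<open>\<Gamma> \<times> X \<rightarrow> X\<close> with the discrete topology on \<open>carrier G\<close>.
  The topology \<open>X\<close> is an arbitrary one; it need not be related to any topology that the type of
  its points may carry by default. Asserting existence of a free flow over a fixed
  point type with continuum many elements loses no generality: for a countable group, a free flow has a free compact metrizable factor,
  density of partial orbits passes to factors, and compact metrizable spaces have at most continuum
  many points.\<close>

definition flow :: "('g, 'm) monoid_scheme \<Rightarrow> 'x topology \<Rightarrow> ('g \<Rightarrow> 'x \<Rightarrow> 'x) \<Rightarrow> bool" where
  "flow G X \<phi> \<longleftrightarrow>
     topspace X \<noteq> {} \<and> compact_space X \<and> Hausdorff_space X \<and>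
     group_action G (topspace X) \<phi> \<and>
     continuous_map (prod_topology (discrete_topology (carrier G)) X) X (\<lambda>(g, x). \<phi> g x)"

definition free_flow :: "('g, 'm) monoid_scheme \<Rightarrow> 'x topology \<Rightarrow> ('g \<Rightarrow> 'x \<Rightarrow> 'x) \<Rightarrow> bool" where
  "free_flow G X \<phi> \<longleftrightarrow>
     flow G X \<phi> \<and>
     (\<forall>x \<in> topspace X. \<forall>g \<in> carrier G. g \<noteq> \<one>\<^bsub>G\<^esub> \<longrightarrow> \<phi> g x \<noteq> x)"

definition minimal_wrt :: "'g set \<Rightarrow> 'x topology \<Rightarrow> ('g \<Rightarrow> 'x \<Rightarrow> 'x) \<Rightarrow> bool" where
  "minimal_wrt S X \<phi> \<longleftrightarrow>
     (\<forall>x \<in> topspace X. X closure_of {\<phi> s x | s. s \<in> S} = topspace X)"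

definition locally_finite_group :: "('g, 'm) monoid_scheme \<Rightarrow> bool" where
  "locally_finite_group G \<longleftrightarrow>
     (\<forall>A. A \<subseteq> carrier G \<and> finite A \<longrightarrow> finite (generate G A))"

end

theory Submission
  imports Defs
begin

text \<open>A countable group has only countably many finitely generated subgroups, and by assumption only
countably many infinite locally finite ones. Hence every infinite
subgroup contains a member of one countable family of infinite subgroups \<open>\<Delta>\<close>: an infinite
finitely generated subgroup if it is not locally finite, and itself otherwise. Since minimality
passes to larger sets, it is enough to find a free flow that is minimal with respect to
countably many given infinite subgroups.

The flow is a closed set of configurations on the group with the shift. It is the limit of a
decreasing sequence of shift-invariant sets \<open>X n\<close>, and in passing to \<open>X (Suc n)\<close>
one makes sure that all patterns of \<open>X n\<close> on some finite window occur along the \<open>\<Delta>\<close>-orbit of every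
point of \<open>X (Suc n)\<close>, within a bounded part of \<open>\<Delta>\<close>. The patterns
of the limit on this window are among those of \<open>X n\<close>, so the limit is minimal with respect to \<open>\<Delta>\<close>. Freeness comes from layers of
proper 3-colourings of the graphs \<open>g \<mapsto> h g\<close>, one for each non-identity element \<open>h\<close>.

To force patterns, one takes a large finite subset of \<open>\<Delta>\<close> as a tile, takes a maximal family of disjoint
right translates of it, and inserts every pattern somewhere into every member of the family. By maximality
there is one within a bounded distance along every \<open>\<Delta>\<close>-orbit, because the tile lies in \<open>\<Delta>\<close>.
There are two difficulties. The first one is that the inserted patterns must not interfere with each other although the tiles
intertwine in a complicated way. Here one needs an independent transversal of large sets with
respect to conflicts of bounded degree (\<open>independent_transversal\<close>). It is obtained by repeated
halving: a union of two matchings is 2-colourable, and if one of the matchings pairs up the elements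
of the sets and the other one consists of conflicts, a colour class is an exact half of each set
without these conflicts.

The second difficulty is that the smaller sets \<open>X n\<close> must still be flexible enough for inserting
patterns, although a pattern that is cut out of a tiled configuration cuts through
tiles. The invariant (\<open>supervised\<close>) is that patterns can be glued after they have been enlarged
such that every tile whose inserted patterns are not included keeps enough room for
them. The enlargement is finite (\<open>ex_finite_closed_superset\<close>) by a counting argument: adding one more inserted pattern costs a
bounded number of points, but it is forced only by a number of points that is much larger. All stages
together keep the total cost below one per point. The heart of the proof is \<open>glue_tiled\<close>, which
shows that the invariant survives the insertion of patterns.\<close>

section \<open>Halving families of finite sets along matchings\<close>

text \<open>A graph whose edges form two perfect matchings \<open>p\<close> and \<open>q\<close> is a disjoint union of even
cycles and two-way infinite paths. Put \<open>t = p \<circ> q\<close>. The component of \<open>v\<close> consists of the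
\<open>t\<close>-orbits of \<open>v\<close> and of \<open>p v\<close>, and these are different orbits: if \<open>p v = t\<^sup>k v\<close>, then, as
\<open>p\<close> conjugates \<open>t\<close> to its inverse, the point \<open>w = t\<^sup>l v\<close> with \<open>l = k div 2\<close> is fixed by \<open>p\<close>
(for even \<open>k\<close>) or by \<open>q\<close> (for odd \<open>k\<close>). So one orbit of each component can be
coloured true and the other one false.\<close>

lemma two_coloring_of_two_perfect_matchings:
  fixes p q :: "'b \<Rightarrow> 'b"
  assumes pp: "\<And>v. p (p v) = v" and qq: "\<And>v. q (q v) = v"
    and pn: "\<And>v. p v \<noteq> v" and qn: "\<And>v. q v \<noteq> v"
  shows "\<exists>f :: 'b \<Rightarrow> bool. \<forall>v. f (p v) \<noteq> f v \<and> f (q v) \<noteq> f v"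
proof -
  define t where "t = p \<circ> q"
  have tinj: "inj t"
    unfolding t_def by (metis comp_apply injI pp qq)
  have tkinj: "(t ^^ k) v = (t ^^ k) w \<longleftrightarrow> v = w" for k v w
    using inj_fn[OF tinj, of k] by (auto dest: injD)
  have tpt: "t (p (t v)) = p v" for v
    by (simp add: t_def pp qq)
  have flip: "(t ^^ k) (p ((t ^^ k) v)) = p v" for k v
  proof (induction k arbitrary: v)
    case (Suc k)
    have "(t ^^ Suc k) (p ((t ^^ Suc k) v)) = t ((t ^^ k) (p ((t ^^ k) (t v))))"
      by (simp add: funpow_swap1)
    also have "\<dots> = p v"
      by (simp add: Suc.IH tpt)
    finally show ?case .
  qed simp
  have sep: "(t ^^ k) v \<noteq> p v" for k v
  proof
    assume eq: "(t ^^ k) v = p v"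
    show False
    proof (cases "even k")
      case True
      then obtain l where "k = l + l"
        by (metis evenE mult_2)
      then have "(t ^^ l) ((t ^^ l) v) = (t ^^ l) (p ((t ^^ l) v))"
        using eq by (simp add: flip funpow_add)
      then show False
        using pn tkinj by metis
    next
      case False
      then obtain l where "k = l + Suc l"
        by (metis oddE mult_2 add_Suc_right Suc_eq_plus1)
      then have "(t ^^ l) (t ((t ^^ l) v)) = (t ^^ l) (p ((t ^^ l) v))"
        using eq by (simp add: flip funpow_add funpow_swap1)
      then have "p (q ((t ^^ l) v)) = p ((t ^^ l) v)"
        by (simp add: tkinj) (simp add: t_def)
      then show False
        using pp qn by metis
    qed
  qed
  define R where "R v w \<longleftrightarrow> (\<exists>k. w = (t ^^ k) v \<or> v = (t ^^ k) w)" for v w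
  have Rrefl: "R v v" for v
    unfolding R_def by (rule exI[of _ 0]) simp
  have Rsym: "R v w \<Longrightarrow> R w v" for v w
    unfolding R_def by blast
  have Rt: "R u (t v) \<longleftrightarrow> R u v" for u v
  proof
    assume "R u (t v)"
    then obtain k where "t v = (t ^^ k) u \<or> u = (t ^^ k) (t v)"
      unfolding R_def by blast
    then consider "t v = (t ^^ k) u" | "u = (t ^^ Suc k) v"
      by (auto simp: funpow_swap1)
    then show "R u v"
    proof cases
      case 2
      then show ?thesis unfolding R_def by blast
    next
      case 1
      show ?thesis
      proof (cases k)
        case 0
        then have "u = (t ^^ 1) v" using 1 by simp
        then show ?thesis unfolding R_def by blast
      next
        case (Suc l)
        then have "t v = t ((t ^^ l) u)" using 1 by simp
        then have "v = (t ^^ l) u" using tinj by (auto dest: injD)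
        then show ?thesis unfolding R_def by blast
      qed
    qed
  next
    assume "R u v"
    then obtain k where "v = (t ^^ k) u \<or> u = (t ^^ k) v"
      unfolding R_def by blast
    then show "R u (t v)"
    proof
      assume "v = (t ^^ k) u"
      then have "t v = (t ^^ Suc k) u" by simp
      then show ?thesis unfolding R_def by blast
    next
      assume u: "u = (t ^^ k) v"
      show ?thesis
      proof (cases k)
        case 0
        then have "t v = (t ^^ 1) u" using u by simp
        then show ?thesis unfolding R_def by blast
      next
        case (Suc l)
        then have "u = (t ^^ l) (t v)" using u by (simp add: funpow_swap1)
        then show ?thesis unfolding R_def by blast
      qed
    qed
  qed
  have Rtk: "R u ((t ^^ k) v) \<longleftrightarrow> R u v" for u v k
    by (induction k) (simp_all add: Rt)
  have Rtrans: "R u w" if "R u v" "R v w" for u v w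
    using that(2) Rtk that(1) unfolding R_def[of v w] by metis
  have Rp: "R (p v) (p w)" if vw: "R v w" for v w
  proof -
    obtain k where "w = (t ^^ k) v \<or> v = (t ^^ k) w"
      using vw unfolding R_def by blast
    then have "p v = (t ^^ k) (p w) \<or> p w = (t ^^ k) (p v)"
      using flip by metis
    then show ?thesis
      unfolding R_def by blast
  qed
  have Rnp: "\<not> R v (p v)" for v
    unfolding R_def using sep[of _ v] sep[of _ "p v"] pp by metis
  \<comment> \<open>\<open>r v\<close> depends on the component of \<open>v\<close> only and selects the orbit that becomes true.\<close>
  define r where "r v = (SOME w. R v w \<or> R (p v) w)" for v
  have r: "R v (r v) \<or> R (p v) (r v)" for v
    unfolding r_def by (rule someI[of _ v]) (simp add: Rrefl)
  have cong: "r v = r w" if "\<And>u. R v u \<or> R (p v) u \<longleftrightarrow> R w u \<or> R (p w) u" for v w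
    unfolding r_def using that by simp
  have r_p: "r (p v) = r v" for v
    by (rule cong) (auto simp: pp)
  have Rq: "R v (p (q v))" for v
    using Rt[of v v] Rrefl by (simp add: t_def)
  have Rq': "R (p v) (q v)" for v
    using Rp[OF Rq[of v]] by (simp add: pp)
  have r_q: "r (q v) = r v" for v
    by (rule cong) (meson Rq Rq' Rtrans Rsym)
  have excl: "R v u \<longleftrightarrow> \<not> R (p v) u" if "R v u \<or> R (p v) u" for v u
    using that Rnp Rtrans Rsym by meson
  define f where "f v = R v (r v)" for v
  have "f (p v) \<noteq> f v" for v
    using excl[OF r[of v]] unfolding f_def r_p by blast
  moreover have "f (q v) \<noteq> f v" for v
  proof -
    have "R (q v) (r v) \<longleftrightarrow> R (p v) (r v)"
      using Rq' Rtrans Rsym by meson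
    then show ?thesis
      using excl[OF r[of v]] unfolding f_def r_q by blast
  qed
  ultimately show ?thesis
    by (intro exI[of _ f]) simp
qed

text \<open>Matchings that leave points uncovered become perfect on the double cover \<open>V \<times> bool\<close>, where an
uncovered point is matched with its twin.\<close>

lemma two_coloring_of_two_matchings:
  fixes p q :: "'b \<Rightarrow> 'b"
  assumes pp: "\<And>v. p (p v) = v" and qq: "\<And>v. q (q v) = v"
  shows "\<exists>f :: 'b \<Rightarrow> bool. \<forall>v. (p v \<noteq> v \<longrightarrow> f (p v) \<noteq> f v) \<and> (q v \<noteq> v \<longrightarrow> f (q v) \<noteq> f v)"
proof -
  define lift where "lift g = (\<lambda>(v :: 'b, s). if g v = v then (v, \<not> s) else (g v, s))" for g
  have lift2: "lift g (lift g z) = z" "lift g z \<noteq> z" if "\<And>v. g (g v) = v" for g z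
    using that by (auto simp: lift_def split: prod.splits if_splits)
  have "\<exists>f :: 'b \<times> bool \<Rightarrow> bool. \<forall>z. f (lift p z) \<noteq> f z \<and> f (lift q z) \<noteq> f z"
    by (rule two_coloring_of_two_perfect_matchings) (rule lift2, rule assms)+
  then obtain f :: "'b \<times> bool \<Rightarrow> bool" where f: "\<And>z. f (lift p z) \<noteq> f z" "\<And>z. f (lift q z) \<noteq> f z"
    by blast
  show ?thesis
  proof (intro exI allI conjI impI)
    fix v
    show "f (p v, True) \<noteq> f (v, True)" if "p v \<noteq> v"
      using f(1)[of "(v, True)"] that by (simp add: lift_def)
    show "f (q v, True) \<noteq> f (v, True)" if "q v \<noteq> v"
      using f(2)[of "(v, True)"] that by (simp add: lift_def)
  qed
qed

lemma ex_pairing: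
  assumes "finite Q" "even (card Q)"
  shows "\<exists>p. (\<forall>v\<in>Q. p v \<in> Q \<and> p v \<noteq> v \<and> p (p v) = v)"
proof -
  obtain n where n: "card Q = n + n"
    using assms(2) by (metis evenE mult_2)
  then obtain A where A: "A \<subseteq> Q" "card A = n"
    by (metis le_add1 obtain_subset_with_card_n)
  have finA: "finite A" using A(1) assms(1) finite_subset by blast
  have "card (Q - A) = n"
    using A n finA by (simp add: card_Diff_subset)
  then obtain b where b: "bij_betw b A (Q - A)"
    using A(2) assms(1) finA by (metis finite_Diff finite_same_card_bij)
  define p where "p v = (if v \<in> A then b v else the_inv_into A b v)" for v
  have "p v \<in> Q \<and> p v \<noteq> v \<and> p (p v) = v" if v: "v \<in> Q" for v
  proof (cases "v \<in> A")
    case True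
    then have "b v \<in> Q - A" using b by (auto simp: bij_betw_def)
    then show ?thesis
      using True b by (auto simp: p_def the_inv_into_f_f bij_betw_def)
  next
    case False
    then obtain w where w: "w \<in> A" "v = b w"
      using v b by (auto simp: bij_betw_def)
    then show ?thesis
      using False b A(1) by (auto simp: p_def the_inv_into_f_f bij_betw_def)
  qed
  then show ?thesis by blast
qed

text \<open>Pair up the elements inside each \<open>Q t\<close>. A 2-colouring that is proper for these pairs and for the
matching \<open>q\<close> picks exactly one element of each pair, and never both ends of an edge of \<open>q\<close>.\<close>

lemma halve_avoiding_matching:
  fixes q :: "'b \<Rightarrow> 'b"
  assumes fin: "\<And>t. t \<in> T \<Longrightarrow> finite (Q t)" and card: "\<And>t. t \<in> T \<Longrightarrow> card (Q t) = 2 * n"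
    and disj: "\<And>s t. s \<in> T \<Longrightarrow> t \<in> T \<Longrightarrow> s \<noteq> t \<Longrightarrow> Q s \<inter> Q t = {}"
    and qq: "\<And>v. q (q v) = v"
  shows "\<exists>Q'. (\<forall>t\<in>T. Q' t \<subseteq> Q t \<and> card (Q' t) = n) \<and>
     (\<forall>s\<in>T. \<forall>t\<in>T. \<forall>v\<in>Q' s. q v \<in> Q' t \<longrightarrow> q v = v)"
proof -
  have "\<exists>p. \<forall>v\<in>Q t. p v \<in> Q t \<and> p v \<noteq> v \<and> p (p v) = v" if "t \<in> T" for t
    using ex_pairing[OF fin[OF that]] card[OF that] by simp
  then obtain P where P: "\<And>t v. t \<in> T \<Longrightarrow> v \<in> Q t \<Longrightarrow> P t v \<in> Q t \<and> P t v \<noteq> v \<and> P t (P t v) = v"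
    by metis
  define p where "p v = (if \<exists>t\<in>T. v \<in> Q t then P (SOME t. t \<in> T \<and> v \<in> Q t) v else v)" for v
  have p_eq: "p v = P t v" if "t \<in> T" "v \<in> Q t" for t v
  proof -
    have "(SOME t. t \<in> T \<and> v \<in> Q t) = t"
      by (rule some_equality) (use that disj in auto)
    then show ?thesis
      using that by (auto simp: p_def)
  qed
  have pp: "p (p v) = v" for v
  proof (cases "\<exists>t\<in>T. v \<in> Q t")
    case True
    then obtain t where t: "t \<in> T" "v \<in> Q t" by blast
    then have "p v = P t v" "p (P t v) = P t (P t v)" "P t (P t v) = v"
      using P[OF t] p_eq[OF t(1)] by blast+
    then show ?thesis
      by simp
  next
    case False
    then have "p v = v" by (simp add: p_def)
    then show ?thesis by simp
  qed
  obtain f :: "'b \<Rightarrow> bool" where f: "\<And>v. p v \<noteq> v \<Longrightarrow> f (p v) \<noteq> f v" "\<And>v. q v \<noteq> v \<Longrightarrow> f (q v) \<noteq> f v"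
    using two_coloring_of_two_matchings[of p q] pp qq by metis
  define Q' where "Q' t = {v \<in> Q t. f v}" for t
  have "card (Q' t) = n" if t: "t \<in> T" for t
  proof -
    have pQ: "p v \<in> Q t" "p v \<noteq> v" if "v \<in> Q t" for v
      using P[OF t that] p_eq[OF t that] by auto
    have im: "p ` Q' t = Q t - Q' t"
    proof
      show "p ` Q' t \<subseteq> Q t - Q' t"
        using pQ f(1) by (auto simp: Q'_def)
      show "Q t - Q' t \<subseteq> p ` Q' t"
      proof
        fix v assume "v \<in> Q t - Q' t"
        then have "p v \<in> Q' t" using pQ f(1) by (auto simp: Q'_def)
        then show "v \<in> p ` Q' t" using pp by (metis imageI)
      qed
    qed
    have "inj_on p (Q' t)" using pp by (metis inj_onI)
    then have "card (Q t - Q' t) = card (Q' t)" using im card_image by metis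
    moreover have "card (Q t - Q' t) = card (Q t) - card (Q' t)"
      using fin[OF t] by (intro card_Diff_subset) (auto simp: Q'_def)
    moreover have "card (Q' t) \<le> card (Q t)"
      using fin[OF t] by (intro card_mono) (auto simp: Q'_def)
    ultimately show ?thesis
      using card[OF t] by linarith
  qed
  moreover have "q v = v" if "v \<in> Q' s" "q v \<in> Q' t" for s t v
    using that f(2) by (auto simp: Q'_def)
  ultimately show ?thesis
    by (intro exI[of _ Q']) (auto simp: Q'_def)
qed

text \<open>One halving for each matching; sets of size \<open>2 ^ length qs\<close> still have a point left at the end.\<close>

lemma independent_choice_matchings:
  fixes qs :: "('b \<Rightarrow> 'b) list"
  assumes "\<And>t. t \<in> T \<Longrightarrow> finite (Q t)" and "\<And>t. t \<in> T \<Longrightarrow> card (Q t) = 2 ^ length qs"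
    and "\<And>s t. s \<in> T \<Longrightarrow> t \<in> T \<Longrightarrow> s \<noteq> t \<Longrightarrow> Q s \<inter> Q t = {}"
    and "\<And>q v. q \<in> set qs \<Longrightarrow> q (q v) = v"
  shows "\<exists>c. (\<forall>t\<in>T. c t \<in> Q t) \<and>
     (\<forall>s\<in>T. \<forall>t\<in>T. \<forall>q\<in>set qs. q (c s) = c t \<longrightarrow> c t = c s)"
  using assms
proof (induction qs arbitrary: Q)
  case Nil
  have "\<exists>v. v \<in> Q t" if "t \<in> T" for t
    using Nil.prems(2)[OF that] by (metis card.empty ex_in_conv list.size(3) power_0 zero_neq_one)
  then have "\<forall>t\<in>T. (SOME v. v \<in> Q t) \<in> Q t"
    using someI_ex by fast
  then show ?case
    by (intro exI[of _ "\<lambda>t. SOME v. v \<in> Q t"]) simp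
next
  case (Cons q qs)
  obtain Q' where Q': "\<And>t. t \<in> T \<Longrightarrow> Q' t \<subseteq> Q t" "\<And>t. t \<in> T \<Longrightarrow> card (Q' t) = 2 ^ length qs"
      "\<And>s t v. s \<in> T \<Longrightarrow> t \<in> T \<Longrightarrow> v \<in> Q' s \<Longrightarrow> q v \<in> Q' t \<Longrightarrow> q v = v"
  proof -
    have "\<exists>Q'. (\<forall>t\<in>T. Q' t \<subseteq> Q t \<and> card (Q' t) = 2 ^ length qs) \<and>
       (\<forall>s\<in>T. \<forall>t\<in>T. \<forall>v\<in>Q' s. q v \<in> Q' t \<longrightarrow> q v = v)"
      by (rule halve_avoiding_matching) (use Cons.prems in auto)
    then show ?thesis
      using that by blast
  qed
  have "\<exists>c. (\<forall>t\<in>T. c t \<in> Q' t) \<and> (\<forall>s\<in>T. \<forall>t\<in>T. \<forall>q\<in>set qs. q (c s) = c t \<longrightarrow> c t = c s)"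
  proof (rule Cons.IH)
    show "finite (Q' t)" if "t \<in> T" for t
      using Q'(1) Cons.prems(1) that finite_subset by metis
    show "Q' s \<inter> Q' t = {}" if "s \<in> T" "t \<in> T" "s \<noteq> t" for s t
      using Q'(1) Cons.prems(3) that by blast
    show "q' (q' v) = v" if "q' \<in> set qs" for q' v
      using Cons.prems(4) that by simp
  qed (use Q' in auto)
  then obtain c where c: "\<And>t. t \<in> T \<Longrightarrow> c t \<in> Q' t"
    and c': "\<And>s t q. s \<in> T \<Longrightarrow> t \<in> T \<Longrightarrow> q \<in> set qs \<Longrightarrow> q (c s) = c t \<Longrightarrow> c t = c s"
    by metis
  have "c t = c s" if "s \<in> T" "t \<in> T" "q' \<in> set (q # qs)" "q' (c s) = c t" for s t q'
  proof (cases "q' = q")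
    case True
    then show ?thesis
      using Q'(3)[OF that(1,2) c[OF that(1)]] c[OF that(2)] that(4) by simp
  next
    case False
    then show ?thesis
      using c'[OF that(1,2)] that(3,4) by simp
  qed
  then show ?case
    using c Q'(1) by blast
qed

section \<open>Closing finite sets under threshold rules\<close>

text \<open>A rule \<open>(R, A, h)\<close> demands that a set which contains at least \<open>h\<close> points of \<open>R\<close> contains all
of \<open>A\<close>. Rules describe how a partial configuration must be enlarged before it can be transplanted:
when too many points of a slot \<open>R\<close> are obstructed by what is already fixed, the choice \<open>A\<close> that
was made for this slot has to be fixed as well.\<close>

type_synonym 'a rule = "'a set \<times> 'a set \<times> nat"

definition closed_under :: "'a rule set \<Rightarrow> 'a set \<Rightarrow> bool" where
  "closed_under \<R> U \<longleftrightarrow> (\<forall>(R, A, h) \<in> \<R>. h \<le> card (R \<inter> U) \<longrightarrow> A \<subseteq> U)"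

definition rule_cost :: "'a rule \<Rightarrow> real" where
  "rule_cost = (\<lambda>(R, A, h). card A / h)"

text \<open>Each point of \<open>R\<close> contributes \<open>card A / h\<close> to a rule, so that the \<open>h\<close> points which trigger the
rule pay for \<open>A\<close>. The contributions of a single point to all rules add up to at most \<open>\<rho>\<close>.\<close>

definition light :: "real \<Rightarrow> 'a rule set \<Rightarrow> bool" where
  "light \<rho> \<R> \<longleftrightarrow> (\<forall>(R, A, h) \<in> \<R>. finite A \<and> 0 < h) \<and>
     (\<forall>\<T> u. finite \<T> \<and> \<T> \<subseteq> \<R> \<longrightarrow> sum rule_cost {r \<in> \<T>. u \<in> fst r} \<le> \<rho>)"

lemma light_Un:
  assumes "light \<rho> \<R>" "light \<sigma> \<S>"
  shows "light (\<rho> + \<sigma>) (\<R> \<union> \<S>)"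
  unfolding light_def
proof (intro conjI allI impI)
  show "\<forall>(R, A, h)\<in>\<R> \<union> \<S>. finite A \<and> 0 < h"
    using assms by (auto simp: light_def)
  fix \<T> u assume T: "finite \<T> \<and> \<T> \<subseteq> \<R> \<union> \<S>"
  have nonneg: "0 \<le> rule_cost r" for r :: "'a rule"
    by (simp add: rule_cost_def case_prod_beta)
  have "sum rule_cost {r \<in> \<T>. u \<in> fst r}
      \<le> sum rule_cost ({r \<in> \<T> \<inter> \<R>. u \<in> fst r} \<union> {r \<in> \<T> \<inter> \<S>. u \<in> fst r})"
    by (rule sum_mono2) (use T nonneg in auto)
  also have "\<dots> \<le> sum rule_cost {r \<in> \<T> \<inter> \<R>. u \<in> fst r} + sum rule_cost {r \<in> \<T> \<inter> \<S>. u \<in> fst r}"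
    by (subst sum_Un) (use T nonneg in \<open>auto intro!: sum_nonneg\<close>)
  also have "\<dots> \<le> \<rho> + \<sigma>"
  proof (rule add_mono)
    have "finite (\<T> \<inter> \<R>)" "\<T> \<inter> \<R> \<subseteq> \<R>" "finite (\<T> \<inter> \<S>)" "\<T> \<inter> \<S> \<subseteq> \<S>"
      using T by auto
    then show "sum rule_cost {r \<in> \<T> \<inter> \<R>. u \<in> fst r} \<le> \<rho>"
      and "sum rule_cost {r \<in> \<T> \<inter> \<S>. u \<in> fst r} \<le> \<sigma>"
      using assms unfolding light_def by blast+
  qed
  finally show "sum rule_cost {r \<in> \<T>. u \<in> fst r} \<le> \<rho> + \<sigma>" .
qed

text \<open>A set \<open>U\<close> that arises from \<open>W\<close> by adding the conclusions of triggered rules satisfies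
\<open>card U \<le> card W + \<rho> * card U\<close>, because every added point is paid for by points of \<open>U\<close>.
So the cascade of forced enlargements stops: among the sets of this kind, one of maximal size
is closed.\<close>

lemma ex_finite_closed_superset:
  fixes W :: "'a set"
  assumes light: "light \<rho> \<R>" and \<rho>: "\<rho> < 1" and finW: "finite W"
  shows "\<exists>U. finite U \<and> W \<subseteq> U \<and> closed_under \<R> U"
proof -
  define union where "union \<T> = W \<union> (\<Union>(R, A, h) \<in> \<T>. A)" for \<T> :: "'a rule set"
  define supp where "supp \<T> \<longleftrightarrow> finite \<T> \<and> \<T> \<subseteq> \<R> \<and> (\<forall>(R, A, h)\<in>\<T>. h \<le> card (R \<inter> union \<T>))"
    for \<T>
  have finU: "finite (union \<T>)" if "supp \<T>" for \<T>
    using that light finW unfolding supp_def union_def light_def by fastforce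
  have bound: "card (union \<T>) \<le> card W / (1 - \<rho>)" if T: "supp \<T>" for \<T>
  proof -
    define U where "U = union \<T>"
    have U: "finite U" using finU[OF T] by (simp add: U_def)
    have fT: "finite \<T>" and sub: "\<T> \<subseteq> \<R>" using T by (auto simp: supp_def)
    have "card U \<le> card W + card (\<Union>r\<in>\<T>. fst (snd r))"
      unfolding U_def union_def by (metis (no_types, lifting) card_Un_le case_prod_beta' SUP_cong)
    also have "\<dots> \<le> card W + (\<Sum>r\<in>\<T>. card (fst (snd r)))"
      using card_UN_le[OF fT, of "\<lambda>r. fst (snd r)"] by simp
    finally have "real (card U) \<le> card W + (\<Sum>r\<in>\<T>. real (card (fst (snd r))))"
      by (metis of_nat_add of_nat_le_iff of_nat_sum)
    also have "(\<Sum>r\<in>\<T>. real (card (fst (snd r))))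
        \<le> (\<Sum>r\<in>\<T>. (\<Sum>u\<in>U. if u \<in> fst r then card (fst (snd r)) / snd (snd r) else 0))"
    proof (rule sum_mono)
      fix r assume r: "r \<in> \<T>"
      obtain R A h where r_eq: "r = (R, A, h)" by (cases r)
      have h: "0 < h" using light r sub r_eq unfolding light_def by blast
      have le: "h \<le> card (R \<inter> U)" using T r r_eq unfolding supp_def U_def by blast
      have "real (card A) = card A / h * h" using h by simp
      also have "\<dots> \<le> card A / h * card (R \<inter> U)"
        using le by (intro mult_left_mono) auto
      also have "\<dots> = (\<Sum>u\<in>U \<inter> R. card A / h)"
        by (simp add: Int_commute)
      also have "\<dots> = (\<Sum>u\<in>U. if u \<in> R then card A / h else 0)"
        by (rule sum.inter_restrict[OF U])
      finally show "real (card (fst (snd r)))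
          \<le> (\<Sum>u\<in>U. if u \<in> fst r then card (fst (snd r)) / snd (snd r) else 0)"
        unfolding r_eq fst_conv snd_conv .
    qed
    also have "\<dots> = (\<Sum>u\<in>U. \<Sum>r\<in>\<T>. if u \<in> fst r then card (fst (snd r)) / snd (snd r) else 0)"
      by (rule sum.swap)
    also have "\<dots> \<le> (\<Sum>u\<in>U. \<rho>)"
    proof (rule sum_mono)
      fix u
      have "(\<Sum>r\<in>\<T>. if u \<in> fst r then card (fst (snd r)) / snd (snd r) else 0)
          = sum rule_cost {r \<in> \<T>. u \<in> fst r}"
        by (simp add: sum.inter_filter[OF fT] rule_cost_def case_prod_beta)
      also have "\<dots> \<le> \<rho>"
        using light fT sub unfolding light_def by blast
      finally show "(\<Sum>r\<in>\<T>. if u \<in> fst r then card (fst (snd r)) / snd (snd r) else 0) \<le> \<rho>" .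
    qed
    finally have "card U * (1 - \<rho>) \<le> card W"
      by (simp add: algebra_simps)
    then show ?thesis
      using \<rho> by (simp add: U_def field_simps)
  qed
  define C where "C = {card (union \<T>) | \<T>. supp \<T>}"
  have "supp {}" by (simp add: supp_def)
  then have ne: "C \<noteq> {}" unfolding C_def by blast
  have "C \<subseteq> {..nat \<lfloor>card W / (1 - \<rho>)\<rfloor>}"
    using bound unfolding C_def by (auto simp: le_nat_floor)
  then have finC: "finite C" using finite_subset by blast
  then have "Max C \<in> C" using ne by simp
  then obtain \<T> where T: "supp \<T>" and max: "Max C = card (union \<T>)"
    unfolding C_def by blast
  define U where "U = union \<T>"
  have U: "finite U" using finU[OF T] by (simp add: U_def)
  have "closed_under \<R> U"
    unfolding closed_under_def
  proof safe
    fix R A h a assume r: "(R, A, h) \<in> \<R>" "h \<le> card (R \<inter> U)" and a: "a \<in> A"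
    define \<T>' where "\<T>' = insert (R, A, h) \<T>"
    have un: "union \<T>' = U \<union> A" unfolding \<T>'_def U_def union_def by auto
    have mono: "card (R' \<inter> U) \<le> card (R' \<inter> (U \<union> A))" for R'
      using r(1) light U unfolding light_def by (intro card_mono) auto
    have T': "supp \<T>'"
      unfolding supp_def un
      using T r mono unfolding supp_def \<T>'_def U_def[symmetric]
      by (auto intro: le_trans)
    then have "card (U \<union> A) \<in> C"
      unfolding C_def using un by (intro CollectI exI[of _ \<T>']) simp
    then have "card (U \<union> A) \<le> card U" using finC max by (metis Max_ge U_def)
    moreover have "finite (U \<union> A)" using finU[OF T'] un by simp
    ultimately have "U = U \<union> A" by (metis card_seteq sup_ge1)
    then show "a \<in> U" using a by blast
  qed
  moreover have "W \<subseteq> U" by (simp add: U_def union_def)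
  ultimately show ?thesis using U by blast
qed

section \<open>Independent transversals in countable groups\<close>

text \<open>The group is total on its type, so that no carrier conditions arise. The enumeration of the
type is used for greedy constructions.\<close>

locale enumerated_group = Groups.group mul neutral iv
  for mul :: "'a :: countable \<Rightarrow> 'a \<Rightarrow> 'a" (infixl "\<cdot>" 70) and neutral :: 'a and iv :: "'a \<Rightarrow> 'a"
begin

lemma iv_mul_cancel [simp]: "iv a \<cdot> (a \<cdot> b) = b" "a \<cdot> (iv a \<cdot> b) = b"
  by (simp_all flip: assoc)

lemma left_cancel_iff [simp]: "a \<cdot> b = a \<cdot> c \<longleftrightarrow> b = c"
  by (rule left_cancel)

lemma right_cancel_iff [simp]: "b \<cdot> a = c \<cdot> a \<longleftrightarrow> b = c"
  by (metis assoc right_inverse right_neutral)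

lemmas word_simps = assoc inverse_distrib_swap

lemma mul_iv_eq_iff: "b \<cdot> iv a = d \<longleftrightarrow> b = d \<cdot> a"
  by (auto simp: assoc)

definition translate :: "'a set \<Rightarrow> 'a \<Rightarrow> 'a set" where
  "translate U g = (\<lambda>u. u \<cdot> g) ` U"

lemma mem_translate_iff: "d \<in> translate U g \<longleftrightarrow> d \<cdot> iv g \<in> U"
  unfolding translate_def image_iff by (metis mul_iv_eq_iff)

lemma inj_mul_right: "inj (\<lambda>u. u \<cdot> g)"
  by (rule injI) simp

lemma finite_translate [simp]: "finite (translate U g) \<longleftrightarrow> finite U"
  unfolding translate_def by (rule finite_image_iff) (auto intro: inj_onI)

lemma card_translate [simp]: "card (translate U g) = card U"
  unfolding translate_def by (rule card_image) (auto intro: inj_onI)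

lemma translate_Int: "translate U g \<inter> translate V g = translate (U \<inter> V) g"
  by (auto simp: mem_translate_iff)

text \<open>The relation is not symmetric in \<open>U\<close> and \<open>V\<close> unless \<open>D\<close> is closed under inverses; families are
required to be separated in both orders.\<close>

definition separated :: "'a set \<Rightarrow> 'a set \<Rightarrow> 'a set \<Rightarrow> bool" where
  "separated D U V \<longleftrightarrow> (\<forall>u\<in>U. \<forall>v\<in>V. v \<cdot> iv u \<notin> D)"

lemma separated_subset: "separated D U V \<Longrightarrow> D' \<subseteq> D \<Longrightarrow> separated D' U V"
  unfolding separated_def by blast

text \<open>In the graph that joins \<open>g\<close> to \<open>m \<cdot> g\<close> every vertex has at most two neighbours, so colouring
greedily along the enumeration of the group never runs out of three colours, also when a part
of the graph has been properly coloured beforehand.\<close>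

lemma extend_three_coloring:
  assumes m: "m \<noteq> neutral"
    and range: "\<And>u. u \<in> U \<Longrightarrow> c0 u < (3 :: nat)"
    and proper: "\<And>u. u \<in> U \<Longrightarrow> m \<cdot> u \<in> U \<Longrightarrow> c0 u \<noteq> c0 (m \<cdot> u)"
  shows "\<exists>c. (\<forall>u\<in>U. c u = c0 u) \<and> (\<forall>g. c g < 3 \<and> c g \<noteq> c (m \<cdot> g))"
proof -
  define P :: "('a \<Rightarrow> nat) \<Rightarrow> 'a \<Rightarrow> nat \<Rightarrow> bool" where
    "P f g k \<longleftrightarrow> k < 3 \<and> (if g \<in> U then k = c0 g else
       (\<forall>w\<in>{m \<cdot> g, iv m \<cdot> g}. (w \<in> U \<longrightarrow> k \<noteq> c0 w) \<and>
          (w \<notin> U \<and> to_nat w < to_nat g \<longrightarrow> k \<noteq> f w)))" for f g k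
  have "\<exists>f. \<forall>g. P f g (f g)"
  proof (rule dependent_wf_choice[of "Wellfounded.measure to_nat"])
    show "\<exists>k. P f g k" for f g
    proof (cases "g \<in> U")
      case True
      then show ?thesis using range by (auto simp: P_def)
    next
      case False
      define k1 where "k1 = (if m \<cdot> g \<in> U then c0 (m \<cdot> g) else f (m \<cdot> g))"
      define k2 where "k2 = (if iv m \<cdot> g \<in> U then c0 (iv m \<cdot> g) else f (iv m \<cdot> g))"
      have "\<exists>k<3. k \<noteq> k1 \<and> k \<noteq> k2"
        by presburger
      then show ?thesis
        using False by (auto simp: P_def k1_def k2_def)
    qed
  qed (auto simp: P_def)
  then obtain f where f: "\<And>g. P f g (f g)" by blast
  have fU: "f g = c0 g" if "g \<in> U" for g
    using f[of g] that by (simp add: P_def)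
  have "f g \<noteq> f (m \<cdot> g)" for g
  proof -
    have ne: "m \<cdot> g \<noteq> g"
      using m by (metis left_neutral right_cancel_iff)
    consider "g \<in> U" "m \<cdot> g \<in> U" | "g \<notin> U" "m \<cdot> g \<in> U" | "g \<in> U" "m \<cdot> g \<notin> U"
      | "g \<notin> U" "m \<cdot> g \<notin> U" "to_nat (m \<cdot> g) < to_nat g"
      | "g \<notin> U" "m \<cdot> g \<notin> U" "to_nat g < to_nat (m \<cdot> g)"
      using ne by (metis linorder_neqE_nat to_nat_split)
    then show ?thesis
    proof cases
      case 1
      then show ?thesis using fU proper by metis
    next
      case 2
      then show ?thesis using f[of g] fU[of "m \<cdot> g"] by (simp add: P_def)
    next
      case 3
      then show ?thesis using f[of "m \<cdot> g"] fU[of g] by (auto simp: P_def)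
    next
      case 4
      then show ?thesis using f[of g] by (simp add: P_def)
    next
      case 5
      then show ?thesis using f[of "m \<cdot> g"] by (auto simp: P_def)
    qed
  qed
  moreover have "f g < 3" for g
    using f[of g] by (simp add: P_def)
  ultimately show ?thesis
    using fU by (intro exI[of _ f]) simp
qed

text \<open>For fixed \<open>m\<close> the pairs \<open>(g, m \<cdot> g)\<close> form paths and cycles. Splitting them according to the
colour of \<open>g\<close> in a proper 3-colouring \<open>\<kappa> m\<close> gives three matchings \<open>\<sigma> m 0\<close>, \<open>\<sigma> m 1\<close>, \<open>\<sigma> m 2\<close>.
All conflicts prescribed by \<open>M\<close> are thus edges of \<open>3 * card M\<close> matchings. The bound on the size
of the sets does not depend on how many of the sets interact with each other.\<close>

lemma independent_transversal:
  assumes finM: "finite M" and finQ: "\<And>t. t \<in> T \<Longrightarrow> finite (Q t)"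
    and cardQ: "\<And>t. t \<in> T \<Longrightarrow> 2 ^ (3 * card M) \<le> card (Q t)"
    and disj: "\<And>s t. s \<in> T \<Longrightarrow> t \<in> T \<Longrightarrow> s \<noteq> t \<Longrightarrow> Q s \<inter> Q t = {}"
  shows "\<exists>c. (\<forall>t\<in>T. c t \<in> Q t) \<and> (\<forall>s\<in>T. \<forall>t\<in>T. s \<noteq> t \<longrightarrow> c t \<cdot> iv (c s) \<notin> M)"
proof -
  have "\<exists>\<kappa>. m \<noteq> neutral \<longrightarrow> (\<forall>g. \<kappa> g < (3 :: nat) \<and> \<kappa> g \<noteq> \<kappa> (m \<cdot> g))" for m
    using extend_three_coloring[of m "{}" "\<lambda>_. 0"] by (cases "m = neutral") auto
  then obtain \<kappa> :: "'a \<Rightarrow> 'a \<Rightarrow> nat" where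
    \<kappa>: "\<And>m g. m \<noteq> neutral \<Longrightarrow> \<kappa> m g < 3" "\<And>m g. m \<noteq> neutral \<Longrightarrow> \<kappa> m g \<noteq> \<kappa> m (m \<cdot> g)"
    by metis
  define \<sigma> where "\<sigma> m i v = (if \<kappa> m v = i then m \<cdot> v
      else if \<kappa> m (iv m \<cdot> v) = i then iv m \<cdot> v else v)" for m i v
  have \<sigma>\<sigma>: "\<sigma> m i (\<sigma> m i v) = v" if "m \<noteq> neutral" for m i v
    using \<kappa>(2)[OF that, of v] by (simp add: \<sigma>_def)
  obtain ms where ms: "set ms = M - {neutral}" "distinct ms"
    using finM by (metis finite_Diff finite_distinct_list)
  define qs where "qs = concat (map (\<lambda>m. map (\<sigma> m) [0, 1, 2]) ms)"
  have "length qs = 3 * length ms"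
    unfolding qs_def by (induction ms) auto
  also have "\<dots> \<le> 3 * card M"
    using finM ms by (metis Diff_subset card_mono distinct_card mult_le_mono2)
  finally have len: "(2 :: nat) ^ length qs \<le> 2 ^ (3 * card M)"
    by (intro power_increasing) auto
  have "\<exists>Q'. Q' \<subseteq> Q t \<and> card Q' = 2 ^ length qs" if "t \<in> T" for t
    using obtain_subset_with_card_n[OF order.trans[OF len cardQ[OF that]]] by metis
  then obtain Q' where Q': "\<And>t. t \<in> T \<Longrightarrow> Q' t \<subseteq> Q t" "\<And>t. t \<in> T \<Longrightarrow> card (Q' t) = 2 ^ length qs"
    by metis
  have mem_qs: "q \<in> set qs \<longleftrightarrow> (\<exists>m\<in>M - {neutral}. \<exists>i\<in>{0,1,2}. q = \<sigma> m i)" for q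
    unfolding qs_def using ms(1) by auto
  have "\<exists>c. (\<forall>t\<in>T. c t \<in> Q' t) \<and> (\<forall>s\<in>T. \<forall>t\<in>T. \<forall>q\<in>set qs. q (c s) = c t \<longrightarrow> c t = c s)"
  proof (rule independent_choice_matchings)
    show "finite (Q' t)" if "t \<in> T" for t
      using Q'(1) finQ that finite_subset by metis
    show "Q' s \<inter> Q' t = {}" if "s \<in> T" "t \<in> T" "s \<noteq> t" for s t
      using Q'(1)[of s] Q'(1)[of t] disj that by blast
    show "q (q v) = v" if "q \<in> set qs" for q v
      using that \<sigma>\<sigma> unfolding mem_qs by auto
  qed (use Q' in auto)
  then obtain c where c: "\<And>t. t \<in> T \<Longrightarrow> c t \<in> Q' t"
    and indep: "\<And>s t q. s \<in> T \<Longrightarrow> t \<in> T \<Longrightarrow> q \<in> set qs \<Longrightarrow> q (c s) = c t \<Longrightarrow> c t = c s"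
    by blast
  have "c t \<cdot> iv (c s) \<notin> M" if st: "s \<in> T" "t \<in> T" "s \<noteq> t" for s t
  proof
    define m where "m = c t \<cdot> iv (c s)"
    assume "c t \<cdot> iv (c s) \<in> M"
    then have m: "m \<in> M" by (simp add: m_def)
    have ct: "c t = m \<cdot> c s" by (simp add: m_def assoc)
    have ne: "c t \<noteq> c s"
      using c Q'(1) disj st by (metis disjoint_iff subsetD)
    then have m1: "m \<noteq> neutral" using ct by auto
    have "\<sigma> m (\<kappa> m (c s)) \<in> set qs"
      unfolding mem_qs using m m1 \<kappa>(1)[OF m1, of "c s"]
      by (intro bexI[of _ m] bexI[of _ "\<kappa> m (c s)"]) (auto simp: less_Suc_eq numeral_3_eq_3)
    moreover have "\<sigma> m (\<kappa> m (c s)) (c s) = c t"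
      by (simp add: \<sigma>_def ct)
    ultimately show False
      using indep st(1,2) ne by blast
  qed
  then show ?thesis
    using c Q'(1) by (intro exI[of _ c]) blast
qed

end

section \<open>Layered configurations and their gluing\<close>

text \<open>A configuration assigns to each group element an infinite word; its \<open>i\<close>-th letter is called
layer \<open>i\<close>.\<close>

type_synonym 'a config = "'a \<Rightarrow> nat \<Rightarrow> nat"

definition agree :: "nat \<Rightarrow> 'a set \<Rightarrow> 'a config \<Rightarrow> 'a config \<Rightarrow> bool" where
  "agree n U x y \<longleftrightarrow> (\<forall>u\<in>U. \<forall>i<n. x u i = y u i)"

lemma agree_sym: "agree n U x y \<Longrightarrow> agree n U y x"
  by (simp add: agree_def)

lemma agree_trans: "agree n U x y \<Longrightarrow> agree n U y z \<Longrightarrow> agree n U x z"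
  by (simp add: agree_def)

lemma agree_mono: "agree n U x y \<Longrightarrow> V \<subseteq> U \<Longrightarrow> agree n V x y"
  by (auto simp: agree_def)

context enumerated_group begin

definition shift :: "'a \<Rightarrow> 'a config \<Rightarrow> 'a config" where
  "shift g x = (\<lambda>d. x (d \<cdot> g))"

lemma shift_shift: "shift g (shift h x) = shift (g \<cdot> h) x"
  by (simp add: shift_def assoc)

lemma shift_neutral [simp]: "shift neutral x = x"
  by (simp add: shift_def)

lemma agree_shift_iff: "agree n U (shift g x) (shift g y) \<longleftrightarrow> agree n (translate U g) x y"
  by (simp add: agree_def shift_def translate_def)

end

text \<open>Layer \<open>i\<close> of an admissible configuration takes at most three values and distinguishes \<open>g\<close> from
\<open>h i \<cdot> g\<close>. The latter condition is invariant under right translations and makes \<open>h i\<close> act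
without fixed points.\<close>

locale colored_group = enumerated_group mul neutral iv
  for mul :: "'a :: countable \<Rightarrow> 'a \<Rightarrow> 'a" (infixl "\<cdot>" 70) and neutral :: 'a and iv :: "'a \<Rightarrow> 'a" +
  fixes h :: "nat \<Rightarrow> 'a"
  assumes h_neq: "h i \<noteq> neutral"
begin

definition colorings :: "'a config set" where
  "colorings = {x. \<forall>g i. x g i < 3 \<and> x g i \<noteq> x (h i \<cdot> g) i}"

lemma shift_colorings: "x \<in> colorings \<Longrightarrow> shift g x \<in> colorings"
  by (simp add: colorings_def shift_def assoc)

text \<open>The invariant that is carried through the construction. The predicate \<open>good x U\<close> says that the
restriction of \<open>x\<close> to \<open>U\<close> (in the layers below \<open>n\<close>) can be transplanted: any number of good pieces
that are far from each other, as measured by one finite set \<open>D\<close> for pieces of all sizes, occur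
together in a point of \<open>X\<close>. The rules provide the good pieces: by
\<open>ex_finite_closed_superset\<close>, every finite set is contained in a finite one that is good for \<open>x\<close>.
A uniform gluing distance for arbitrary pieces would be too much to ask for, since what a
piece forces can extend arbitrarily far beyond it.\<close>

definition supervised ::
  "nat \<Rightarrow> 'a config set \<Rightarrow> ('a config \<Rightarrow> 'a set \<Rightarrow> bool) \<Rightarrow> 'a set \<Rightarrow> real \<Rightarrow> bool" where
  "supervised n X good D \<rho> \<longleftrightarrow> finite D \<and> \<rho> < 1 \<and>
     (\<forall>x\<in>X. \<exists>\<R>. light \<rho> \<R> \<and> (\<forall>U. closed_under \<R> U \<longrightarrow> good x U)) \<and>
     (\<forall>x U g. good x U \<longrightarrow> good (shift g x) (translate U (iv g))) \<and>
     (\<forall>\<P>. (\<forall>(x, U)\<in>\<P>. x \<in> X \<and> good x U) \<and>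
          (\<forall>p\<in>\<P>. \<forall>q\<in>\<P>. p \<noteq> q \<longrightarrow> separated D (snd p) (snd q)) \<longrightarrow>
        (\<exists>x\<in>X. \<forall>(y, U)\<in>\<P>. agree n U x y))"

lemma supervisedD:
  assumes "supervised n X good D \<rho>"
  shows "finite D" "\<rho> < 1"
    and "x \<in> X \<Longrightarrow> \<exists>\<R>. light \<rho> \<R> \<and> (\<forall>U. closed_under \<R> U \<longrightarrow> good x U)"
    and "good x U \<Longrightarrow> good (shift g x) (translate U (iv g))"
    and "(\<And>y U. (y, U) \<in> \<P> \<Longrightarrow> y \<in> X \<and> good y U) \<Longrightarrow>
      (\<And>p q. p \<in> \<P> \<Longrightarrow> q \<in> \<P> \<Longrightarrow> p \<noteq> q \<Longrightarrow> separated D (snd p) (snd q)) \<Longrightarrow>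
      \<exists>x\<in>X. \<forall>(y, U)\<in>\<P>. agree n U x y"
proof -
  note sup = assms[unfolded supervised_def]
  show "finite D" "\<rho> < 1"
    using sup by auto
  show "x \<in> X \<Longrightarrow> \<exists>\<R>. light \<rho> \<R> \<and> (\<forall>U. closed_under \<R> U \<longrightarrow> good x U)"
    using sup by blast
  show "good x U \<Longrightarrow> good (shift g x) (translate U (iv g))"
    using sup by blast
  assume "\<And>y U. (y, U) \<in> \<P> \<Longrightarrow> y \<in> X \<and> good y U"
    "\<And>p q. p \<in> \<P> \<Longrightarrow> q \<in> \<P> \<Longrightarrow> p \<noteq> q \<Longrightarrow> separated D (snd p) (snd q)"
  then have "(\<forall>(x, U)\<in>\<P>. x \<in> X \<and> good x U) \<and>
          (\<forall>p\<in>\<P>. \<forall>q\<in>\<P>. p \<noteq> q \<longrightarrow> separated D (snd p) (snd q))"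
    by auto
  then show "\<exists>x\<in>X. \<forall>(y, U)\<in>\<P>. agree n U x y"
    using sup by meson
qed

text \<open>A set of configurations that only restricts the layers below \<open>n\<close>, apart from the colouring
conditions.\<close>

definition cylindrical :: "nat \<Rightarrow> 'a config set \<Rightarrow> bool" where
  "cylindrical n X \<longleftrightarrow> X \<subseteq> colorings \<and> (\<forall>x\<in>X. \<forall>g. shift g x \<in> X) \<and>
     (\<forall>x\<in>X. \<forall>y\<in>colorings. agree n UNIV x y \<longrightarrow> y \<in> X)"

lemma cylindrical_colorings: "cylindrical 0 colorings"
  by (simp add: cylindrical_def shift_colorings)

lemma cylindrical_Suc: "cylindrical n X \<Longrightarrow> cylindrical (Suc n) X"
  unfolding cylindrical_def agree_def by (meson less_Suc_eq)

lemma ex_coloring: "colorings \<noteq> {}"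
proof -
  have "\<exists>c. \<forall>g. c g < (3 :: nat) \<and> c g \<noteq> c (h i \<cdot> g)" for i
    using extend_three_coloring[OF h_neq, of "{}" "\<lambda>_. 0" i] by auto
  then obtain c where "\<And>i g. c i g < (3 :: nat) \<and> c i g \<noteq> c i (h i \<cdot> g)"
    by metis
  then have "(\<lambda>g i. c i g) \<in> colorings"
    by (simp add: colorings_def)
  then show ?thesis by blast
qed

lemma supervised_colorings: "supervised 0 colorings (\<lambda>_ _. True) {} 0"
  unfolding supervised_def using ex_coloring
  by (auto simp: agree_def light_def intro!: exI[of _ "{}"])

text \<open>Layer \<open>n\<close> is not restricted by \<open>X\<close>, so after the lower layers have been glued it is chosen as a
3-colouring that extends the given pieces. The new elements of \<open>D\<close> ensure that the pieces are
disjoint and that no edge of the graph of \<open>h n\<close> joins two of them.\<close>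

lemma supervised_Suc:
  assumes sup: "supervised n X good D \<rho>" and cyl: "cylindrical n X"
  shows "supervised (Suc n) X good (D \<union> {neutral, h n, iv (h n)}) \<rho>"
  unfolding supervised_def
proof (intro conjI allI impI ballI)
  let ?D = "D \<union> {neutral, h n, iv (h n)}"
  fix \<P> assume "(\<forall>(x, U)\<in>\<P>. x \<in> X \<and> good x U) \<and>
    (\<forall>p\<in>\<P>. \<forall>q\<in>\<P>. p \<noteq> q \<longrightarrow> separated ?D (snd p) (snd q))"
  then have good: "\<And>y U. (y, U) \<in> \<P> \<Longrightarrow> y \<in> X \<and> good y U"
    and sep: "\<And>p q. p \<in> \<P> \<Longrightarrow> q \<in> \<P> \<Longrightarrow> p \<noteq> q \<Longrightarrow> separated ?D (snd p) (snd q)"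
    by auto
  have "\<exists>x\<in>X. \<forall>(y, U)\<in>\<P>. agree n U x y"
    by (rule supervisedD(5)[OF sup good]) (auto intro: separated_subset[OF sep])
  then obtain x where x: "x \<in> X" "\<And>y U. (y, U) \<in> \<P> \<Longrightarrow> agree n U x y"
    by blast
  have col: "y u i < 3" "y u i \<noteq> y (h i \<cdot> u) i" if "(y, U) \<in> \<P>" for y U u i
    using good[OF that] cyl unfolding cylindrical_def colorings_def by blast+
  have same: "p = q" if "p \<in> \<P>" "q \<in> \<P>" "u \<in> snd p" "w \<in> snd q" "w \<cdot> iv u \<in> ?D" for p q u w
    using sep[OF that(1,2)] that unfolding separated_def by blast
  define V where "V = (\<Union>p\<in>\<P>. snd p)"
  define y0 where "y0 u = fst (SOME p. p \<in> \<P> \<and> u \<in> snd p) u n" for u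
  have y0: "y0 u = y u n" if "(y, U) \<in> \<P>" "u \<in> U" for y U u
  proof -
    have "(SOME p. p \<in> \<P> \<and> u \<in> snd p) = (y, U)"
    proof (rule some_equality)
      show "p = (y, U)" if "p \<in> \<P> \<and> u \<in> snd p" for p
        by (rule same[of p "(y, U)" u u]) (use that \<open>(y, U) \<in> \<P>\<close> \<open>u \<in> U\<close> in simp_all)
    qed (use that in simp)
    then show ?thesis by (simp add: y0_def)
  qed
  have "\<exists>c. (\<forall>u\<in>V. c u = y0 u) \<and> (\<forall>g. c g < 3 \<and> c g \<noteq> c (h n \<cdot> g))"
  proof (rule extend_three_coloring[OF h_neq])
    fix u assume "u \<in> V"
    then obtain y U where yU: "(y, U) \<in> \<P>" "u \<in> U" by (auto simp: V_def)
    show "y0 u < 3" using y0[OF yU] col(1)[OF yU(1)] by simp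
    assume "h n \<cdot> u \<in> V"
    then obtain z W where zW: "(z, W) \<in> \<P>" "h n \<cdot> u \<in> W" by (auto simp: V_def)
    have "(y, U) = (z, W)"
      by (rule same[OF yU(1) zW(1), of u "h n \<cdot> u"]) (use yU zW in \<open>auto simp: assoc\<close>)
    then show "y0 u \<noteq> y0 (h n \<cdot> u)"
      using y0[OF yU] y0[OF zW] col(2)[OF yU(1)] by simp
  qed
  then obtain c where c: "\<And>u. u \<in> V \<Longrightarrow> c u = y0 u" "\<And>g. c g < 3" "\<And>g. c g \<noteq> c (h n \<cdot> g)"
    by blast
  define x' where "x' g i = (if i = n then c g else x g i)" for g i
  have "x \<in> colorings" using x(1) cyl by (auto simp: cylindrical_def)
  then have "x' \<in> colorings" using c by (auto simp: colorings_def x'_def)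
  moreover have "agree n UNIV x x'" by (simp add: agree_def x'_def)
  ultimately have "x' \<in> X" using x(1) cyl unfolding cylindrical_def by blast
  moreover have "agree (Suc n) U x' y" if "(y, U) \<in> \<P>" for y U
    unfolding agree_def
  proof (intro ballI allI impI)
    fix u i assume u: "u \<in> U" and "i < Suc n"
    have "u \<in> V" using that u by (force simp: V_def)
    then show "x' u i = y u i"
      using c(1) y0[OF that u] x(2)[OF that] u \<open>i < Suc n\<close> by (auto simp: x'_def agree_def less_Suc_eq)
  qed
  ultimately show "\<exists>x\<in>X. \<forall>(y, U)\<in>\<P>. agree (Suc n) U x y" by blast
qed (use supervisedD[OF sup] in auto)

end

section \<open>Forcing finitely many patterns on every orbit\<close>

text \<open>If \<open>m \<cdot> c\<close> avoids a set \<open>V\<close> for all \<open>m\<close> in the halo, then \<open>V\<close> and a copy of a subset of \<open>T\<close>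
placed at \<open>c\<close> are \<open>D\<close>-separated.\<close>

definition (in enumerated_group) halo :: "'a set \<Rightarrow> 'a set \<Rightarrow> 'a set" where
  "halo D T = (\<lambda>(d, t). d \<cdot> t) ` ((D \<union> iv ` D) \<times> T)"

text \<open>If \<open>c' \<cdot> iv c\<close> is not a clash, then copies of subsets of \<open>T\<close> placed at \<open>c\<close> and \<open>c'\<close> are
\<open>D\<close>-separated.\<close>

definition (in enumerated_group) clashes :: "'a set \<Rightarrow> 'a set \<Rightarrow> 'a set" where
  "clashes D T = (\<lambda>(s, d, t). iv s \<cdot> d \<cdot> t) ` (T \<times> D \<times> T)"

text \<open>The good patterns \<open>y j\<close> on \<open>U j\<close>, for \<open>j < r\<close>, are to occur along every orbit of a subgroup that
contains the disjoint finite sets \<open>B j\<close>. Their union is the tile, and a pattern \<open>j\<close> will be placed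
somewhere in the slot \<open>B j \<cdot> e\<close> of each translate \<open>tile \<cdot> e\<close> of a maximal packing. The threshold
\<open>k\<close> is large in comparison to the patterns, which makes the new rules cheap, and the slots are
large in comparison to \<open>k\<close>: fewer than \<open>k\<close> obstructing points leave enough room in a slot for an
independent transversal. It matters that both bounds involve only the number of elements
of the halo and of the clashes, which are independent of the size of the tile.\<close>

locale pattern_tiling = colored_group mul neutral iv h
  for mul :: "'a :: countable \<Rightarrow> 'a \<Rightarrow> 'a" (infixl "\<cdot>" 70) and neutral :: 'a
    and iv :: "'a \<Rightarrow> 'a" and h :: "nat \<Rightarrow> 'a" +
  fixes n :: nat and X :: "'a config set" and good :: "'a config \<Rightarrow> 'a set \<Rightarrow> bool"
    and D :: "'a set" and \<rho> \<sigma> :: real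
    and r :: nat and y :: "nat \<Rightarrow> 'a config" and U :: "nat \<Rightarrow> 'a set" and T :: "'a set"
    and B :: "nat \<Rightarrow> 'a set" and k :: nat
  assumes sup: "supervised n X good D \<rho>" and cyl: "cylindrical n X"
    and r_pos: "0 < r" and y_in: "j < r \<Longrightarrow> y j \<in> X" and good_y: "j < r \<Longrightarrow> good (y j) (U j)"
    and finT: "finite T" and U_sub: "j < r \<Longrightarrow> U j \<subseteq> T"
    and k_pos: "0 < k" and cost: "card (halo D T) * card T / k \<le> \<sigma>" and lt1: "\<rho> + \<sigma> < 1"
    and finB: "j < r \<Longrightarrow> finite (B j)"
    and disjB: "i < r \<Longrightarrow> j < r \<Longrightarrow> i \<noteq> j \<Longrightarrow> B i \<inter> B j = {}"
    and cardB: "j < r \<Longrightarrow> card (halo D T) * k + 2 ^ (3 * card (clashes D T)) \<le> card (B j)"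
begin

definition "tile = (\<Union>j<r. B j)"

definition packing :: "'a set \<Rightarrow> bool" where
  "packing E \<longleftrightarrow> (\<forall>e\<in>E. \<forall>e'\<in>E. \<forall>b\<in>tile. \<forall>b'\<in>tile. b \<cdot> e = b' \<cdot> e' \<longrightarrow> e = e')"

definition saturated :: "'a set \<Rightarrow> bool" where
  "saturated E \<longleftrightarrow> (\<forall>g. \<exists>e\<in>E. \<exists>b\<in>tile. \<exists>b'\<in>tile. b \<cdot> g = b' \<cdot> e)"

text \<open>The pair \<open>(E, c)\<close> consists of the centres of a maximal packing and the positions of the patterns
in the slots. It is a witness and not part of the configuration, so \<open>tiled\<close> below is a
subset of \<open>X\<close>.\<close>

definition tiles :: "'a set \<Rightarrow> ('a \<Rightarrow> nat \<Rightarrow> 'a) \<Rightarrow> 'a config \<Rightarrow> bool" where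
  "tiles E c x \<longleftrightarrow> packing E \<and> saturated E \<and>
     (\<forall>e\<in>E. \<forall>j<r. c e j \<in> translate (B j) e \<and> agree n (U j) (shift (c e j) x) (y j))"

definition tiled :: "'a config set" where
  "tiled = {x \<in> X. \<exists>E c. tiles E c x}"

text \<open>The points whose presence in a transplanted piece can obstruct a position in slot \<open>j\<close> of the tile
at \<open>e\<close>.\<close>

definition region :: "'a \<Rightarrow> nat \<Rightarrow> 'a set" where
  "region e j = (\<lambda>(m, b). m \<cdot> b \<cdot> e) ` (halo D T \<times> B j)"

definition slot_rule :: "('a \<Rightarrow> nat \<Rightarrow> 'a) \<Rightarrow> 'a \<Rightarrow> nat \<Rightarrow> 'a rule" where
  "slot_rule c e j = (region e j, translate (U j) (c e j), k)"

definition slot_rules :: "'a set \<Rightarrow> ('a \<Rightarrow> nat \<Rightarrow> 'a) \<Rightarrow> 'a rule set" where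
  "slot_rules E c = {slot_rule c e j | e j. e \<in> E \<and> j < r}"

definition tiled_good :: "'a config \<Rightarrow> 'a set \<Rightarrow> bool" where
  "tiled_good x V \<longleftrightarrow> good x V \<and> (\<exists>E c. tiles E c x \<and> closed_under (slot_rules E c) V)"

text \<open>If a point \<open>v\<close> obstructs a position in the tile at \<open>e\<close>, then \<open>e \<in> reach \<cdot> v\<close>, and the same holds
for the centre of every tile that meets the tile at \<open>e\<close>. The set \<open>spread\<close> is a gluing distance
at which tiles within reach of different pieces are disjoint.\<close>

definition reach :: "'a set" where
  "reach = (\<lambda>(b, b', b'', m). iv b \<cdot> b' \<cdot> iv b'' \<cdot> iv m) ` (tile \<times> tile \<times> tile \<times> halo D T)"

definition spread :: "'a set" where
  "spread = D \<union> (\<lambda>(b, s, b', t). iv (b \<cdot> s) \<cdot> (b' \<cdot> t)) ` (tile \<times> reach \<times> tile \<times> reach)"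

lemma finD: "finite D"
  using supervisedD(1)[OF sup] .

lemma fin_halo: "finite (halo D T)"
  by (simp add: halo_def finD finT)

lemma fin_clashes: "finite (clashes D T)"
  by (simp add: clashes_def finD finT)

lemma fin_tile: "finite tile"
  by (simp add: tile_def finB)

lemma B_tile: "j < r \<Longrightarrow> b \<in> B j \<Longrightarrow> b \<in> tile"
  by (auto simp: tile_def)

lemma fin_spread: "finite spread"
  by (simp add: spread_def reach_def fin_tile fin_halo finD)

lemma fin_region: "j < r \<Longrightarrow> finite (region e j)"
  by (simp add: region_def fin_halo finB)

lemma tile_nonempty: "tile \<noteq> {}"
proof -
  have "card (B 0) \<noteq> 0"
    using cardB[OF r_pos] by (metis add_is_0 le_zero_eq power_not_zero zero_neq_numeral)
  then show ?thesis
    unfolding tile_def using r_pos by force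
qed

lemma packing_slot_unique:
  assumes "packing E" "e \<in> E" "e' \<in> E" "i < r" "j < r" "b \<in> B i" "b' \<in> B j" "b \<cdot> e = b' \<cdot> e'"
  shows "e = e' \<and> i = j"
proof -
  have "e = e'"
    using assms B_tile unfolding packing_def by blast
  then have "b = b'" using assms(8) by simp
  then show ?thesis
    using disjB assms \<open>e = e'\<close> by blast
qed

lemma extend_packing:
  assumes "packing E0"
  shows "\<exists>E. E0 \<subseteq> E \<and> packing E \<and> saturated E"
proof -
  define \<A> where "\<A> = {E. E0 \<subseteq> E \<and> packing E}"
  have "\<exists>M\<in>\<A>. \<forall>E\<in>\<A>. M \<subseteq> E \<longrightarrow> E = M"
  proof (rule subset_Zorn_nonempty)
    show "\<A> \<noteq> {}" using assms by (auto simp: \<A>_def)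
    fix \<C> assume C: "\<C> \<noteq> {}" "subset.chain \<A> \<C>"
    have "packing (\<Union>\<C>)"
      unfolding packing_def
    proof (intro ballI impI)
      fix e e' b b' assume e: "e \<in> \<Union>\<C>" "e' \<in> \<Union>\<C>" and b: "b \<in> tile" "b' \<in> tile" "b \<cdot> e = b' \<cdot> e'"
      obtain E1 E2 where E12: "E1 \<in> \<C>" "e \<in> E1" "E2 \<in> \<C>" "e' \<in> E2"
        using e by blast
      then have "E1 \<subseteq> E2 \<or> E2 \<subseteq> E1"
        using C(2) unfolding subset_chain_def by blast
      then obtain E where "E \<in> \<C>" "e \<in> E" "e' \<in> E"
        using E12 by blast
      moreover have "packing E"
        using \<open>E \<in> \<C>\<close> C(2) unfolding subset_chain_def \<A>_def by blast
      ultimately show "e = e'"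
        using b unfolding packing_def by blast
    qed
    moreover have "E0 \<subseteq> \<Union>\<C>"
      using C unfolding subset_chain_def \<A>_def by blast
    ultimately show "\<Union>\<C> \<in> \<A>" by (simp add: \<A>_def)
  qed
  then obtain M where M: "M \<in> \<A>" and max: "\<And>E. E \<in> \<A> \<Longrightarrow> M \<subseteq> E \<Longrightarrow> E = M"
    by blast
  have "saturated M"
    unfolding saturated_def
  proof (rule allI, rule ccontr)
    fix g assume no: "\<not> (\<exists>e\<in>M. \<exists>b\<in>tile. \<exists>b'\<in>tile. b \<cdot> g = b' \<cdot> e)"
    have "packing (insert g M)"
      unfolding packing_def
    proof (intro ballI impI)
      fix e e' b b' assume e: "e \<in> insert g M" "e' \<in> insert g M"
        and b: "b \<in> tile" "b' \<in> tile" "b \<cdot> e = b' \<cdot> e'"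
      consider "e = g" "e' = g" | "e = g" "e' \<in> M" | "e' = g" "e \<in> M" | "e \<in> M" "e' \<in> M"
        using e by blast
      then show "e = e'"
      proof cases
        case 2
        then show ?thesis using no b by blast
      next
        case 3
        then show ?thesis using no b by metis
      next
        case 4
        then show ?thesis using M b unfolding \<A>_def packing_def by blast
      qed simp
    qed
    then have "g \<in> M"
      using max[of "insert g M"] M by (auto simp: \<A>_def)
    then show False
      using no tile_nonempty by blast
  qed
  then show ?thesis
    using M by (auto simp: \<A>_def)
qed

lemma tiles_shift:
  assumes "tiles E c x"
  shows "tiles (translate E (iv g)) (\<lambda>e j. c (e \<cdot> g) j \<cdot> iv g) (shift g x)"
  unfolding tiles_def
proof (intro conjI ballI allI impI)
  note t = assms[unfolded tiles_def]
  show "packing (translate E (iv g))"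
    unfolding packing_def
  proof (intro ballI impI)
    fix e e' b b' assume a: "e \<in> translate E (iv g)" "e' \<in> translate E (iv g)"
      "b \<in> tile" "b' \<in> tile" "b \<cdot> e = b' \<cdot> e'"
    have "b \<cdot> (e \<cdot> g) = b' \<cdot> (e' \<cdot> g)"
      using a(5) by (simp flip: assoc)
    moreover have "e \<cdot> g \<in> E" "e' \<cdot> g \<in> E"
      using a(1,2) by (simp_all add: mem_translate_iff)
    ultimately have "e \<cdot> g = e' \<cdot> g"
      using t a(3,4) unfolding packing_def by blast
    then show "e = e'" by simp
  qed
  show "saturated (translate E (iv g))"
    unfolding saturated_def
  proof
    fix d
    obtain e b b' where e: "e \<in> E" "b \<in> tile" "b' \<in> tile" "b \<cdot> (d \<cdot> g) = b' \<cdot> e"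
      using t unfolding saturated_def by blast
    have "b \<cdot> d = b \<cdot> (d \<cdot> g) \<cdot> iv g" by (simp add: assoc)
    then have "b \<cdot> d = b' \<cdot> (e \<cdot> iv g)" using e(4) by (simp add: assoc)
    moreover have "e \<cdot> iv g \<in> translate E (iv g)"
      using e(1) by (simp add: translate_def)
    ultimately show "\<exists>e\<in>translate E (iv g). \<exists>b\<in>tile. \<exists>b'\<in>tile. b \<cdot> d = b' \<cdot> e"
      using e by blast
  qed
  fix e j assume "e \<in> translate E (iv g)" and j: "j < r"
  then have e: "e \<cdot> g \<in> E" by (simp add: mem_translate_iff)
  then have "c (e \<cdot> g) j \<in> translate (B j) (e \<cdot> g)"
    using t j by blast
  then show "c (e \<cdot> g) j \<cdot> iv g \<in> translate (B j) e"
    by (simp add: mem_translate_iff word_simps)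
  show "agree n (U j) (shift (c (e \<cdot> g) j \<cdot> iv g) (shift g x)) (y j)"
    using t j e by (simp add: shift_shift assoc)
qed

lemma tiled_cylindrical: "cylindrical n tiled"
proof -
  have "shift g x \<in> tiled" if "x \<in> tiled" for x g
    using that tiles_shift cyl unfolding tiled_def cylindrical_def by blast
  moreover have "x' \<in> tiled" if x: "x \<in> tiled" and x': "x' \<in> colorings" "agree n UNIV x x'" for x x'
  proof -
    obtain E c where t: "tiles E c x" using x by (auto simp: tiled_def)
    have "agree n V (shift g x') (shift g x)" for V g
      using x'(2) by (simp add: agree_def shift_def)
    then have "tiles E c x'"
      using t agree_trans unfolding tiles_def by blast
    moreover have "x' \<in> X"
      using x x' cyl unfolding tiled_def cylindrical_def by blast
    ultimately show ?thesis by (auto simp: tiled_def)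
  qed
  ultimately show ?thesis
    using cyl unfolding cylindrical_def tiled_def by blast
qed

text \<open>A point \<open>u\<close> in \<open>region e j\<close> has the form \<open>m \<cdot> b \<cdot> e\<close> with \<open>m\<close> in the halo, and \<open>b \<cdot> e\<close>
determines the slot because the tiles are disjoint. So at most \<open>card (halo D T)\<close> rules charge \<open>u\<close>.\<close>

lemma light_slot_rules:
  assumes t: "tiles E c x"
  shows "light \<sigma> (slot_rules E c)"
  unfolding light_def
proof (intro conjI allI impI)
  show "\<forall>(R, A, i)\<in>slot_rules E c. finite A \<and> 0 < i"
    using k_pos finite_subset[OF U_sub finT] by (auto simp: slot_rules_def slot_rule_def)
  fix \<T> u assume T: "finite \<T> \<and> \<T> \<subseteq> slot_rules E c"
  define \<S> where "\<S> = {r \<in> \<T>. u \<in> fst r}"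
  define P where "P s m \<longleftrightarrow> m \<in> halo D T \<and>
     (\<exists>e\<in>E. \<exists>j<r. \<exists>b\<in>B j. s = slot_rule c e j \<and> u = m \<cdot> (b \<cdot> e))" for s m
  have "\<exists>m. P s m" if "s \<in> \<S>" for s
  proof -
    have "s \<in> slot_rules E c" using that T by (auto simp: \<S>_def)
    then obtain e j where ej: "e \<in> E" "j < r" "s = slot_rule c e j"
      unfolding slot_rules_def by blast
    then have "u \<in> region e j"
      using that by (simp add: \<S>_def slot_rule_def)
    then show ?thesis
      using ej unfolding P_def region_def by (auto simp: assoc)
  qed
  then obtain \<mu> where \<mu>: "\<And>s. s \<in> \<S> \<Longrightarrow> P s (\<mu> s)" by metis
  have "inj_on \<mu> \<S>"
  proof (rule inj_onI)
    fix s s' assume s: "s \<in> \<S>" "s' \<in> \<S>" "\<mu> s = \<mu> s'"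
    obtain e j b where 1: "e \<in> E" "j < r" "b \<in> B j" "s = slot_rule c e j" "u = \<mu> s \<cdot> (b \<cdot> e)"
      using \<mu>[OF s(1)] unfolding P_def by blast
    obtain e' j' b' where 2: "e' \<in> E" "j' < r" "b' \<in> B j'" "s' = slot_rule c e' j'" "u = \<mu> s' \<cdot> (b' \<cdot> e')"
      using \<mu>[OF s(2)] unfolding P_def by blast
    have "\<mu> s \<cdot> (b \<cdot> e) = \<mu> s \<cdot> (b' \<cdot> e')" using 1(5) 2(5) s(3) by simp
    then have "b \<cdot> e = b' \<cdot> e'" by simp
    then have "e = e' \<and> j = j'"
      using packing_slot_unique[of E e e' j j' b b'] t 1 2 unfolding tiles_def by blast
    then show "s = s'" using 1 2 by simp
  qed
  moreover have "\<mu> ` \<S> \<subseteq> halo D T" using \<mu> unfolding P_def by blast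
  ultimately have card: "card \<S> \<le> card (halo D T)"
    using fin_halo card_inj_on_le by blast
  have "rule_cost s \<le> card T / k" if "s \<in> \<S>" for s
  proof -
    have "s \<in> slot_rules E c" using that T by (auto simp: \<S>_def)
    then obtain e j where ej: "j < r" "s = slot_rule c e j"
      unfolding slot_rules_def by blast
    then show ?thesis
      using card_mono[OF finT U_sub[OF ej(1)]]
      by (simp add: slot_rule_def rule_cost_def divide_right_mono)
  qed
  then have "sum rule_cost \<S> \<le> card \<S> * (card T / k)"
    by (metis of_nat_mult sum_bounded_above)
  also have "\<dots> \<le> card (halo D T) * (card T / k)"
    using card by (intro mult_right_mono) auto
  also have "\<dots> \<le> \<sigma>" using cost by simp
  finally show "sum rule_cost {r \<in> \<T>. u \<in> fst r} \<le> \<sigma>" by (simp add: \<S>_def)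
qed

lemma tiled_good_shift:
  assumes "tiled_good x V"
  shows "tiled_good (shift g x) (translate V (iv g))"
proof -
  obtain E c where g: "good x V" and t: "tiles E c x" and cl: "closed_under (slot_rules E c) V"
    using assms unfolding tiled_good_def by blast
  define E' where "E' = translate E (iv g)"
  define c' where "c' e j = c (e \<cdot> g) j \<cdot> iv g" for e j
  have reg: "region e j = translate (region (e \<cdot> g) j) (iv g)" for e j
    unfolding region_def translate_def by (force simp: image_image assoc)
  have tr: "translate A (a \<cdot> b) = translate (translate A a) b" for A a b
    unfolding translate_def by (simp add: image_image assoc)
  have mono: "translate A a \<subseteq> translate A' a \<longleftrightarrow> A \<subseteq> A'" for A A' a
    unfolding translate_def by (simp add: inj_image_subset_iff inj_mul_right)
  have "closed_under (slot_rules E' c') (translate V (iv g))"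
    unfolding closed_under_def
  proof (intro ballI, clarify)
    fix R A i a assume s: "(R, A, i) \<in> slot_rules E' c'" and i: "i \<le> card (R \<inter> translate V (iv g))"
      and a: "a \<in> A"
    obtain e j where e: "e \<in> E'" "j < r" "(R, A, i) = slot_rule c' e j"
      using s unfolding slot_rules_def by blast
    have eg: "e \<cdot> g \<in> E" using e(1) by (simp add: E'_def mem_translate_iff)
    have "k \<le> card (region (e \<cdot> g) j \<inter> V)"
      using i e(3) reg[of e j] by (simp add: slot_rule_def translate_Int)
    then have "translate (U j) (c (e \<cdot> g) j) \<subseteq> V"
      using cl eg e(2) unfolding closed_under_def slot_rules_def slot_rule_def by blast
    then have "A \<subseteq> translate V (iv g)"
      using e(3) by (simp add: slot_rule_def c'_def tr mono)
    then show "a \<in> translate V (iv g)" using a by blast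
  qed
  moreover have "tiles E' c' (shift g x)"
    using tiles_shift[OF t] unfolding E'_def c'_def .
  moreover have "good (shift g x) (translate V (iv g))"
    by (rule supervisedD(4)[OF sup g])
  ultimately show ?thesis
    by (auto simp: tiled_good_def)
qed


text \<open>Let the pieces \<open>(x, V)\<close> be given. Tiles of the witness for \<open>x\<close> that lie near \<open>V\<close> are kept; by
separation, tiles kept for different pieces are disjoint, and together they extend to a maximal
packing \<open>E\<close>. A slot is settled if its rule is triggered by a piece. Then the rule says that
the piece contains the pattern of this slot. In any other slot fewer than \<open>k\<close>
points obstruct positions, all of them from one piece, so many positions are free.
New positions for all these slots are chosen by an independent transversal. The old pieces and
the patterns at the new positions are then separated good pieces for \<open>X\<close>, and a point of \<open>X\<close>
in which all of them occur is tiled by \<open>E\<close>.\<close>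

lemma glue_tiled:
  assumes good: "\<And>x V. (x, V) \<in> \<P> \<Longrightarrow> x \<in> tiled \<and> tiled_good x V"
    and sep: "\<And>p q. p \<in> \<P> \<Longrightarrow> q \<in> \<P> \<Longrightarrow> p \<noteq> q \<Longrightarrow> separated spread (snd p) (snd q)"
  shows "\<exists>x\<in>tiled. \<forall>(z, V)\<in>\<P>. agree n V x z"
proof -
  have "\<exists>E c. tiles E c (fst p) \<and> closed_under (slot_rules E c) (snd p)" if "p \<in> \<P>" for p
    using good[of "fst p" "snd p"] that by (simp add: tiled_good_def)
  then obtain EE cc where tiles: "\<And>p. p \<in> \<P> \<Longrightarrow> tiles (EE p) (cc p) (fst p)"
    and closed: "\<And>p. p \<in> \<P> \<Longrightarrow> closed_under (slot_rules (EE p) (cc p)) (snd p)"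
    by metis
  define near where "near p = {e \<in> EE p. \<exists>v\<in>snd p. \<exists>s\<in>reach. e = s \<cdot> v}" for p
  have unique: "p = q" if "p \<in> \<P>" "q \<in> \<P>" "v \<in> snd p" "w \<in> snd q" "s \<in> reach" "t \<in> reach"
      "b \<in> tile" "b' \<in> tile" "b \<cdot> (s \<cdot> v) = b' \<cdot> (t \<cdot> w)" for p q v w s t b b'
  proof (rule ccontr)
    assume "p \<noteq> q"
    have "w = iv (b' \<cdot> t) \<cdot> (b \<cdot> s) \<cdot> v"
      using that(9) by (simp add: word_simps)
    then have "w \<cdot> iv v = iv (b' \<cdot> t) \<cdot> (b \<cdot> s)"
      by (simp add: mul_iv_eq_iff)
    also have "\<dots> \<in> spread"
      using that(5-8) unfolding spread_def by (intro UnI2 image_eqI[of _ _ "(b', t, b, s)"]) auto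
    finally show False
      using sep[OF that(1,2) \<open>p \<noteq> q\<close>] that(3,4) unfolding separated_def by blast
  qed
  define E0 where "E0 = (\<Union>p\<in>\<P>. near p)"
  have "packing E0"
    unfolding packing_def
  proof (intro ballI impI)
    fix e e' b b' assume e: "e \<in> E0" "e' \<in> E0" and b: "b \<in> tile" "b' \<in> tile" "b \<cdot> e = b' \<cdot> e'"
    obtain p v s where p: "p \<in> \<P>" "v \<in> snd p" "s \<in> reach" "e = s \<cdot> v" "e \<in> EE p"
      using e(1) unfolding E0_def near_def by blast
    obtain q w t where q: "q \<in> \<P>" "w \<in> snd q" "t \<in> reach" "e' = t \<cdot> w" "e' \<in> EE q"
      using e(2) unfolding E0_def near_def by blast
    have "p = q"
      using unique[OF p(1) q(1) p(2) q(2) p(3) q(3) b(1,2)] b(3) p(4) q(4) by simp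
    then show "e = e'"
      using tiles[OF p(1)] p(5) q(5) b unfolding tiles_def packing_def by blast
  qed
  then obtain E where E: "E0 \<subseteq> E" "packing E" "saturated E"
    using extend_packing by blast
  \<comment> \<open>By maximality of the packing of \<open>p\<close>, a tile that is obstructed by \<open>p\<close> meets one of its near
    tiles, and both belong to the packing \<open>E\<close>, so they coincide.\<close>
  have touch: "e \<in> near p \<and> (\<exists>v\<in>snd p. \<exists>s\<in>reach. e = s \<cdot> v)"
    if p: "p \<in> \<P>" and e: "e \<in> E" "b \<in> tile" "m \<in> halo D T" "m \<cdot> (b \<cdot> e) \<in> snd p" for e p m b
  proof -
    obtain e2 b1 b2 where e2: "e2 \<in> EE p" "b1 \<in> tile" "b2 \<in> tile" "b1 \<cdot> e = b2 \<cdot> e2"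
      using tiles[OF p] unfolding tiles_def saturated_def by blast
    define v where "v = m \<cdot> (b \<cdot> e)"
    define s where "s = iv b2 \<cdot> b1 \<cdot> iv b \<cdot> iv m"
    have "e2 = iv b2 \<cdot> (b1 \<cdot> e)" using e2(4) by simp
    then have "e2 = s \<cdot> v" by (simp add: s_def v_def assoc)
    moreover have "s \<in> reach"
      unfolding s_def reach_def using e e2 by (intro image_eqI[of _ _ "(b2, b1, b, m)"]) auto
    ultimately have near: "e2 \<in> near p" and ex: "\<exists>v\<in>snd p. \<exists>s\<in>reach. e2 = s \<cdot> v"
      using e2(1) e(4) unfolding near_def v_def by blast+
    then have "e2 \<in> E" using E(1) p by (auto simp: E0_def)
    then have "e = e2"
      using E(2) e(1) e2 unfolding packing_def by blast
    then show ?thesis using near ex by simp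
  qed
  define settled where "settled p e j \<longleftrightarrow> p \<in> \<P> \<and> e \<in> near p \<and> k \<le> card (region e j \<inter> snd p)" for p e j
  define I where "I = {(e, j). e \<in> E \<and> j < r \<and> (\<forall>p. \<not> settled p e j)}"
  define Q where "Q = (\<lambda>(e, j). {d \<in> translate (B j) e. \<forall>p\<in>\<P>. \<forall>m\<in>halo D T. m \<cdot> d \<notin> snd p})"
  have cardQ: "2 ^ (3 * card (clashes D T)) \<le> card (Q t)" if t: "t \<in> I" for t
  proof -
    obtain e j where ej: "t = (e, j)" "e \<in> E" "j < r" and unsettled: "\<And>p. \<not> settled p e j"
      using t by (auto simp: I_def)
    \<comment> \<open>\<open>L\<close> contains the lost positions; they are all obstructed by the same piece \<open>p\<close>.\<close>
    define L where "L = translate (B j) e - Q t"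
    have Q_sub: "Q t \<subseteq> translate (B j) e" by (auto simp: Q_def ej)
    have L: "\<exists>p\<in>\<P>. \<exists>m\<in>halo D T. m \<cdot> d \<in> snd p" if "d \<in> L" for d
      using that by (auto simp: L_def Q_def ej)
    have L_tile: "\<exists>b\<in>B j. b \<in> tile \<and> d = b \<cdot> e" if "d \<in> L" for d
      using that B_tile[OF ej(3)] by (auto simp: L_def translate_def)
    have "card L \<le> card (halo D T) * k"
    proof (cases "L = {}")
      case False
      then obtain d0 where "d0 \<in> L" by blast
      then obtain p b0 m0 where p: "p \<in> \<P>" "b0 \<in> tile" "m0 \<in> halo D T" "m0 \<cdot> (b0 \<cdot> e) \<in> snd p"
        using L L_tile by metis
      note near = touch[OF p(1) ej(2) p(2-4)]
      have "L \<subseteq> (\<lambda>(m, v). iv m \<cdot> v) ` (halo D T \<times> (region e j \<inter> snd p))"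
      proof
        fix d assume d: "d \<in> L"
        obtain q m where q: "q \<in> \<P>" "m \<in> halo D T" "m \<cdot> d \<in> snd q" using L[OF d] by blast
        obtain b where b: "b \<in> B j" "b \<in> tile" "d = b \<cdot> e" using L_tile[OF d] by blast
        have "p = q"
          using near touch[OF q(1) ej(2) b(2) q(2)] q(3) b(3) unique[OF p(1) q(1) _ _ _ _ b(2) b(2)]
          by metis
        moreover have "m \<cdot> d \<in> region e j"
          using b q(2) unfolding region_def by (intro image_eqI[of _ _ "(m, b)"]) (auto simp: assoc)
        ultimately show "d \<in> (\<lambda>(m, v). iv m \<cdot> v) ` (halo D T \<times> (region e j \<inter> snd p))"
          using q by (intro image_eqI[of _ _ "(m, m \<cdot> d)"]) auto
      qed
      moreover have "finite (halo D T \<times> (region e j \<inter> snd p))"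
        using fin_halo fin_region[OF ej(3)] by blast
      ultimately have "card L \<le> card (halo D T) * card (region e j \<inter> snd p)"
        by (metis card_cartesian_product surj_card_le)
      also have "\<dots> \<le> card (halo D T) * k"
        using unsettled[of p] near p(1) by (intro mult_le_mono2) (auto simp: settled_def)
      finally show ?thesis .
    qed simp
    moreover have "card (translate (B j) e) \<le> card L + card (Q t)"
      unfolding L_def using Q_sub finB[OF ej(3)]
      by (metis card_Diff_subset finite_subset finite_translate le_diff_conv order_refl)
    ultimately show ?thesis
      using cardB[OF ej(3)] by simp
  qed
  have "\<exists>c. (\<forall>t\<in>I. c t \<in> Q t) \<and> (\<forall>s\<in>I. \<forall>t\<in>I. s \<noteq> t \<longrightarrow> c t \<cdot> iv (c s) \<notin> clashes D T)"
  proof (rule independent_transversal[OF fin_clashes])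
    show "finite (Q t)" if "t \<in> I" for t
    proof (rule finite_subset)
      show "Q t \<subseteq> translate (B (snd t)) (fst t)" by (auto simp: Q_def split: prod.splits)
    qed (use that finB in \<open>auto simp: I_def\<close>)
    show "Q s \<inter> Q t = {}" if st: "s \<in> I" "t \<in> I" "s \<noteq> t" for s t
    proof (rule ccontr)
      assume "Q s \<inter> Q t \<noteq> {}"
      then obtain d where d: "d \<in> Q s" "d \<in> Q t" by blast
      obtain e i e' j where eq: "s = (e, i)" "t = (e', j)" by fastforce
      obtain b b' where "b \<in> B i" "b' \<in> B j" "b \<cdot> e = b' \<cdot> e'"
        using d eq by (auto simp: Q_def translate_def)
      then have "e = e' \<and> i = j"
        using packing_slot_unique[OF E(2)] st(1,2) eq by (auto simp: I_def)
      then show False using st(3) eq by simp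
    qed
  qed (rule cardQ)
  then obtain c where c_all: "(\<forall>t\<in>I. c t \<in> Q t) \<and>
      (\<forall>s\<in>I. \<forall>t\<in>I. s \<noteq> t \<longrightarrow> c t \<cdot> iv (c s) \<notin> clashes D T)" ..
  have c: "c t \<in> Q t" if "t \<in> I" for t
    using c_all that by blast
  have indep: "c t \<cdot> iv (c s) \<notin> clashes D T" if "s \<in> I" "t \<in> I" "s \<noteq> t" for s t
    using c_all that by blast
  define piece where "piece t = (shift (iv (c t)) (y (snd t)), translate (U (snd t)) (c t))" for t
  have sep_new: "separated D (snd (piece s)) (snd (piece t))" if st: "s \<in> I" "t \<in> I" "s \<noteq> t" for s t
    unfolding separated_def
  proof (intro ballI notI)
    fix u v assume u: "u \<in> snd (piece s)" and v: "v \<in> snd (piece t)" and "v \<cdot> iv u \<in> D"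
    then obtain d where d: "d \<in> D" "v = d \<cdot> u" by (metis mul_iv_eq_iff)
    have j: "snd s < r" "snd t < r" using st by (auto simp: I_def)
    obtain a where a: "a \<in> T" "u = a \<cdot> c s"
      using u U_sub[OF j(1)] by (auto simp: piece_def translate_def)
    obtain a' where a': "a' \<in> T" "v = a' \<cdot> c t"
      using v U_sub[OF j(2)] by (auto simp: piece_def translate_def)
    have "c t = iv a' \<cdot> v" using a' by simp
    then have "c t \<cdot> iv (c s) = iv a' \<cdot> d \<cdot> a"
      using d(2) a(2) by (simp add: mul_iv_eq_iff assoc)
    also have "\<dots> \<in> clashes D T"
      unfolding clashes_def using a a' d by (intro image_eqI[of _ _ "(a', d, a)"]) auto
    finally show False using indep[OF st] by simp
  qed
  have sep_old: "separated D (snd p) (snd (piece t)) \<and> separated D (snd (piece t)) (snd p)"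
    if p: "p \<in> \<P>" and t: "t \<in> I" for p t
  proof -
    have j: "snd t < r" using t by (auto simp: I_def)
    have free: "m \<cdot> c t \<notin> snd p" if "m \<in> halo D T" for m
      using c[OF t] p that by (auto simp: Q_def split: prod.splits)
    have form: "\<exists>a\<in>T. u = a \<cdot> c t" if "u \<in> snd (piece t)" for u
      using that U_sub[OF j] by (auto simp: piece_def translate_def)
    have halo: "d \<cdot> a \<in> halo D T" "iv d \<cdot> a \<in> halo D T" if "d \<in> D" "a \<in> T" for d a
      using that unfolding halo_def by force+
    show ?thesis
      unfolding separated_def
    proof (intro conjI ballI notI)
      fix v u assume v: "v \<in> snd p" and u: "u \<in> snd (piece t)" and "u \<cdot> iv v \<in> D"
      then obtain d where d: "d \<in> D" "u = d \<cdot> v" by (metis mul_iv_eq_iff)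
      obtain a where a: "a \<in> T" "u = a \<cdot> c t" using form[OF u] by blast
      have "v = iv d \<cdot> (a \<cdot> c t)" using d(2) a(2) by (metis iv_mul_cancel(1))
      then show False using free[OF halo(2)[OF d(1) a(1)]] v by (simp add: assoc)
    next
      fix u v assume u: "u \<in> snd (piece t)" and v: "v \<in> snd p" and "v \<cdot> iv u \<in> D"
      then obtain d where d: "d \<in> D" "v = d \<cdot> u" by (metis mul_iv_eq_iff)
      obtain a where a: "a \<in> T" "u = a \<cdot> c t" using form[OF u] by blast
      show False using free[OF halo(1)[OF d(1) a(1)]] v d(2) a(2) by (simp add: assoc)
    qed
  qed
  have D_spread: "D \<subseteq> spread" by (simp add: spread_def)
  have "\<exists>x\<in>X. \<forall>(z, V)\<in>\<P> \<union> piece ` I. agree n V x z"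
  proof (rule supervisedD(5)[OF sup])
    fix z V assume zV: "(z, V) \<in> \<P> \<union> piece ` I"
    show "z \<in> X \<and> good z V"
    proof (cases "(z, V) \<in> \<P>")
      case True
      then show ?thesis using good by (auto simp: tiled_def tiled_good_def)
    next
      case False
      then obtain t where t: "t \<in> I" "(z, V) = piece t" using zV by blast
      have j: "snd t < r" using t by (auto simp: I_def)
      have "y (snd t) \<in> X" "good (y (snd t)) (U (snd t))" using y_in[OF j] good_y[OF j] .
      then have "shift (iv (c t)) (y (snd t)) \<in> X"
        "good (shift (iv (c t)) (y (snd t))) (translate (U (snd t)) (iv (iv (c t))))"
        using cyl supervisedD(4)[OF sup] unfolding cylindrical_def by blast+
      then show ?thesis using t(2) by (simp add: piece_def)
    qed
  next
    fix p q assume pq: "p \<in> \<P> \<union> piece ` I" "q \<in> \<P> \<union> piece ` I" "p \<noteq> q"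
    show "separated D (snd p) (snd q)"
    proof (cases "p \<in> \<P>"; cases "q \<in> \<P>")
      assume "p \<in> \<P>" "q \<in> \<P>"
      then show ?thesis using separated_subset[OF sep D_spread] pq(3) by blast
    next
      assume "p \<in> \<P>" "q \<notin> \<P>"
      then show ?thesis using sep_old pq(2) by blast
    next
      assume "p \<notin> \<P>" "q \<in> \<P>"
      then show ?thesis using sep_old pq(1) by blast
    next
      assume "p \<notin> \<P>" "q \<notin> \<P>"
      then obtain s t where "s \<in> I" "t \<in> I" "p = piece s" "q = piece t" using pq(1,2) by blast
      then show ?thesis using sep_new pq(3) by blast
    qed
  qed
  then obtain x where x: "x \<in> X" and x_all: "\<forall>(z, V)\<in>\<P> \<union> piece ` I. agree n V x z" ..
  have agree: "agree n V x z" if "(z, V) \<in> \<P>" for z V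
    using x_all that by blast
  have agree': "agree n (snd (piece t)) x (fst (piece t))" if "t \<in> I" for t
    using bspec[OF x_all, of "piece t"] that by (simp add: case_prod_beta)
  define c' where "c' e j = (if (e, j) \<in> I then c (e, j) else cc (SOME p. settled p e j) e j)" for e j
  have "tiles E c' x"
    unfolding tiles_def
  proof (intro conjI E ballI allI impI)
    fix e j assume e: "e \<in> E" and j: "j < r"
    have "c' e j \<in> translate (B j) e \<and> agree n (U j) (shift (c' e j) x) (y j)"
    proof (cases "(e, j) \<in> I")
      case True
      have "c (e, j) \<in> translate (B j) e" using c[OF True] by (simp add: Q_def)
      moreover have "agree n (translate (U j) (c (e, j))) x (shift (iv (c (e, j))) (y j))"
        using agree'[OF True] by (simp add: piece_def)
      then have "agree n (U j) (shift (c (e, j)) x) (shift (c (e, j)) (shift (iv (c (e, j))) (y j)))"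
        unfolding agree_shift_iff .
      ultimately show ?thesis using True by (simp add: c'_def shift_shift)
    next
      case False
      define p where "p = (SOME p. settled p e j)"
      have "settled p e j"
        unfolding p_def using False e j by (intro someI_ex[of "\<lambda>p. settled p e j"]) (auto simp: I_def)
      then have p: "p \<in> \<P>" "e \<in> EE p" "k \<le> card (region e j \<inter> snd p)"
        by (auto simp: settled_def near_def)
      have c'_eq: "c' e j = cc p e j" using False by (simp add: c'_def p_def)
      have cp: "cc p e j \<in> translate (B j) e" "agree n (U j) (shift (cc p e j) (fst p)) (y j)"
        using tiles[OF p(1)] p(2) j unfolding tiles_def by blast+
      have "slot_rule (cc p) e j \<in> slot_rules (EE p) (cc p)"
        using p(2) j by (auto simp: slot_rules_def)
      then have "translate (U j) (cc p e j) \<subseteq> snd p"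
        using closed[OF p(1)] p(3) unfolding closed_under_def slot_rule_def by blast
      moreover have "agree n (snd p) x (fst p)" using agree[of "fst p" "snd p"] p(1) by simp
      ultimately have "agree n (U j) (shift (cc p e j) x) (shift (cc p e j) (fst p))"
        unfolding agree_shift_iff by (rule agree_mono[rotated])
      then show ?thesis using cp agree_trans c'_eq by metis
    qed
    then show "c' e j \<in> translate (B j) e" "agree n (U j) (shift (c' e j) x) (y j)" by auto
  qed
  then have "x \<in> tiled" using x by (auto simp: tiled_def)
  then show ?thesis using agree by blast
qed

lemma supervised_tiled: "supervised n tiled tiled_good spread (\<rho> + \<sigma>)"
  unfolding supervised_def
proof (intro conjI allI impI ballI)
  show "finite spread" by (rule fin_spread)
  show "\<rho> + \<sigma> < 1" by (rule lt1)
  show "\<exists>\<R>. light (\<rho> + \<sigma>) \<R> \<and> (\<forall>V. closed_under \<R> V \<longrightarrow> tiled_good x V)" if x: "x \<in> tiled" for x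
  proof -
    obtain E c where t: "x \<in> X" "tiles E c x" using x by (auto simp: tiled_def)
    obtain \<R> where R: "light \<rho> \<R>" "\<And>V. closed_under \<R> V \<Longrightarrow> good x V"
      using supervisedD(3)[OF sup t(1)] by blast
    have "tiled_good x V" if cl: "closed_under (\<R> \<union> slot_rules E c) V" for V
    proof -
      have "closed_under \<R> V" "closed_under (slot_rules E c) V"
        using cl by (auto simp: closed_under_def)
      then show ?thesis using R(2) t(2) by (auto simp: tiled_good_def)
    qed
    then show ?thesis
      using light_Un[OF R(1) light_slot_rules[OF t(2)]] by blast
  qed
  show "tiled_good (shift g x) (translate V (iv g))" if "tiled_good x V" for x V g
    using tiled_good_shift[OF that] .
  show "\<exists>x\<in>tiled. \<forall>(z, V)\<in>\<P>. agree n V x z"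
    if "(\<forall>(x, V)\<in>\<P>. x \<in> tiled \<and> tiled_good x V) \<and>
        (\<forall>p\<in>\<P>. \<forall>q\<in>\<P>. p \<noteq> q \<longrightarrow> separated spread (snd p) (snd q))" for \<P>
    by (rule glue_tiled) (use that in auto)
qed

text \<open>Some tile \<open>tile \<cdot> e\<close> meets \<open>tile\<close>, so \<open>e\<close> is a quotient of two elements of the tile, and every
pattern occurs at a position in \<open>tile \<cdot> e\<close>.\<close>

lemma tiled_hits:
  assumes x: "x \<in> tiled" and j: "j < r"
  shows "\<exists>s\<in>(\<lambda>(a, b, c). a \<cdot> iv b \<cdot> c) ` (tile \<times> tile \<times> tile). agree n (U j) (shift s x) (y j)"
proof -
  obtain E c where t: "tiles E c x" using x by (auto simp: tiled_def)
  then obtain e b b' where e: "e \<in> E" "b \<in> tile" "b' \<in> tile" "b \<cdot> neutral = b' \<cdot> e"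
    unfolding tiles_def saturated_def by blast
  have c: "c e j \<in> translate (B j) e" "agree n (U j) (shift (c e j) x) (y j)"
    using t e(1) j unfolding tiles_def by blast+
  obtain a where a: "a \<in> tile" "c e j = a \<cdot> e"
    using c(1) B_tile[OF j] by (auto simp: translate_def)
  have "e = iv b' \<cdot> b" using e(4) by simp
  then have "c e j = a \<cdot> iv b' \<cdot> b" using a(2) by (simp add: assoc)
  then show ?thesis
    using c(2) a(1) e(2,3) by (intro bexI[of _ "c e j"] image_eqI[of _ _ "(a, b', b)"]) auto
qed

end

section \<open>The inductive step and the limit\<close>

context colored_group begin

definition controlled :: "nat \<Rightarrow> 'a config set \<Rightarrow> bool" where
  "controlled n X \<longleftrightarrow> cylindrical n X \<and> (\<exists>good D \<rho>. supervised n X good D \<rho>)"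

text \<open>Patterns will be found at positions \<open>a \<cdot> iv b \<cdot> c\<close> with \<open>a\<close>, \<open>b\<close>, \<open>c\<close> in
the tile, and these positions must not leave \<open>\<Delta>\<close>.\<close>

definition division_closed :: "'a set \<Rightarrow> bool" where
  "division_closed \<Delta> \<longleftrightarrow> (\<forall>a\<in>\<Delta>. \<forall>b\<in>\<Delta>. \<forall>c\<in>\<Delta>. a \<cdot> iv b \<cdot> c \<in> \<Delta>)"

lemma controlled_nonempty: "controlled n X \<Longrightarrow> X \<noteq> {}"
  using supervisedD(5)[of n X _ _ _ "{}"] unfolding controlled_def by blast

lemma finite_representatives:
  assumes "X \<subseteq> colorings" "finite W"
  shows "\<exists>Y\<subseteq>X. finite Y \<and> (\<forall>x\<in>X. \<exists>y\<in>Y. agree n W x y)"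
proof -
  define f where "f x = restrict (\<lambda>(u, i). x u i) (W \<times> {..<n})" for x :: "'a config"
  have "f ` X \<subseteq> PiE (W \<times> {..<n}) (\<lambda>_. {..<3})"
  proof (rule image_subsetI)
    show "f x \<in> PiE (W \<times> {..<n}) (\<lambda>_. {..<3})" if "x \<in> X" for x
      unfolding f_def restrict_PiE_iff using assms(1) that by (auto simp: colorings_def)
  qed
  moreover have "finite (PiE (W \<times> {..<n}) (\<lambda>_. {..<3 :: nat}))"
    using assms(2) by (intro finite_PiE) auto
  ultimately have "finite (f ` X)" using finite_subset by blast
  then obtain Y where Y: "Y \<subseteq> X" "finite Y" "f ` X = f ` Y"
    using finite_subset_image[of "f ` X" f X] by blast
  have agree: "agree n W x y" if "f x = f y" for x y
    unfolding agree_def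
  proof (intro ballI allI impI)
    fix u i assume "u \<in> W" "i < n"
    then show "x u i = y u i"
      using fun_cong[OF that, of "(u, i)"] by (simp add: f_def)
  qed
  have "\<exists>y\<in>Y. agree n W x y" if "x \<in> X" for x
  proof -
    have "f x \<in> f ` Y" using that Y(3) by blast
    then show ?thesis using agree by blast
  qed
  then show ?thesis using Y by blast
qed

text \<open>The patterns on \<open>W\<close> that occur in \<open>X\<close> are finite in number. Each of them is enlarged to a good
pattern, and then the constants of a tiling are chosen in the order \<open>k\<close>, size \<open>L\<close> of the
slots, disjoint slots inside \<open>\<Delta>\<close>. The weight of the rules stays below one since \<open>\<sigma>\<close> is half of what is
left. All patterns of \<open>X\<close>, and so in particular all those of the smaller set \<open>X'\<close>, occur
along the \<open>\<Delta>\<close>-orbit of each point of \<open>X'\<close>.\<close>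

lemma controlled_step:
  assumes X: "controlled n X" and inf: "infinite \<Delta>" and div: "division_closed \<Delta>" and W: "finite W"
  shows "\<exists>X' F. controlled n X' \<and> X' \<subseteq> X \<and> finite F \<and> F \<subseteq> \<Delta> \<and>
    (\<forall>x\<in>X'. \<forall>z\<in>X. \<exists>s\<in>F. agree n W (shift s x) z)"
proof -
  obtain good D \<rho> where cyl: "cylindrical n X" and sup: "supervised n X good D \<rho>"
    using X unfolding controlled_def by blast
  obtain Y where Y: "Y \<subseteq> X" "finite Y" "\<And>x. x \<in> X \<Longrightarrow> \<exists>y\<in>Y. agree n W x y"
    using finite_representatives[OF _ W, of X n] cyl unfolding cylindrical_def by metis
  define r where "r = card Y"
  obtain y where "bij_betw y {0..<r} Y"
    using ex_bij_betw_nat_finite[OF Y(2)] r_def by blast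
  then have y: "y ` {0..<r} = Y" by (auto simp: bij_betw_def)
  have y_in: "y j \<in> X" if "j < r" for j
    using that y Y(1) by auto
  have r_pos: "0 < r"
    using controlled_nonempty[OF X] Y by (auto simp: r_def card_gt_0_iff)
  have "\<exists>V. finite V \<and> W \<subseteq> V \<and> good (y j) V" if j: "j < r" for j
  proof -
    obtain \<R> where "light \<rho> \<R>" "\<And>V. closed_under \<R> V \<Longrightarrow> good (y j) V"
      using supervisedD(3)[OF sup y_in[OF j]] by blast
    then show ?thesis
      using ex_finite_closed_superset[OF _ supervisedD(2)[OF sup] W] by blast
  qed
  then obtain U where U: "\<And>j. j < r \<Longrightarrow> finite (U j) \<and> W \<subseteq> U j \<and> good (y j) (U j)"
    by metis
  define T where "T = (\<Union>j<r. U j)"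
  have finT: "finite T" using U by (auto simp: T_def)
  define \<sigma> where "\<sigma> = (1 - \<rho>) / 2"
  have \<sigma>: "0 < \<sigma>" "\<rho> + \<sigma> < 1"
    using supervisedD(2)[OF sup] by (auto simp: \<sigma>_def field_simps)
  define a where "a = real (card (halo D T) * card T)"
  obtain k0 :: nat where k0: "a / \<sigma> \<le> k0" using real_arch_simple by blast
  define k where "k = Suc k0"
  have "a / \<sigma> \<le> k" using k0 by (simp add: k_def)
  then have "a / k \<le> \<sigma>" using \<sigma>(1) by (simp add: k_def field_simps)
  define L where "L = card (halo D T) * k + 2 ^ (3 * card (clashes D T))"
  have L_pos: "0 < L" by (simp add: L_def)
  obtain \<phi> :: "nat \<Rightarrow> 'a" where \<phi>: "inj \<phi>" "range \<phi> \<subseteq> \<Delta>"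
    using infinite_countable_subset[OF inf] by blast
  define B where "B j = \<phi> ` {j * L..<Suc j * L}" for j
  have block: "i div L = j" if "i \<in> {j * L..<Suc j * L}" for i j
    using that L_pos by (intro div_nat_eqI) (auto simp: mult.commute)
  interpret pattern_tiling mul neutral iv h n X good D \<rho> \<sigma> r y U T B k
  proof unfold_locales
    show "B i \<inter> B j = {}" if "i \<noteq> j" for i j
    proof (rule ccontr)
      assume "B i \<inter> B j \<noteq> {}"
      then obtain v w where "v \<in> {i * L..<Suc i * L}" "w \<in> {j * L..<Suc j * L}" "\<phi> v = \<phi> w"
        unfolding B_def by blast
      then show False using that block \<phi>(1) by (metis injD)
    qed
    show "card (halo D T) * k + 2 ^ (3 * card (clashes D T)) \<le> card (B j)" for j
    proof -
      have "card (B j) = card {j * L..<Suc j * L}"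
        unfolding B_def using \<phi>(1) by (intro card_image) (auto intro: inj_on_subset)
      then show ?thesis by (simp add: L_def)
    qed
    show "real (card (halo D T) * card T) / k \<le> \<sigma>"
      using \<open>a / k \<le> \<sigma>\<close> by (simp add: a_def)
    show "U j \<subseteq> T" if "j < r" for j
      using that by (auto simp: T_def)
  qed (use sup cyl r_pos y_in U finT \<sigma> in \<open>auto simp: B_def k_def\<close>)
  define F where "F = (\<lambda>(a, b, c). a \<cdot> iv b \<cdot> c) ` (tile \<times> tile \<times> tile)"
  have tile_sub: "tile \<subseteq> \<Delta>"
    using \<phi>(2) by (auto simp: tile_def B_def)
  have "F \<subseteq> \<Delta>"
    using div tile_sub unfolding F_def division_closed_def by auto
  moreover have "finite F" using fin_tile by (simp add: F_def)
  moreover have "\<exists>s\<in>F. agree n W (shift s x) z" if x: "x \<in> tiled" and z: "z \<in> X" for x z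
  proof -
    obtain j where j: "j < r" "agree n W z (y j)"
      using Y(3)[OF z] y by auto
    obtain s where s: "s \<in> F" "agree n (U j) (shift s x) (y j)"
      using tiled_hits[OF x j(1)] unfolding F_def by blast
    then have "agree n W (shift s x) (y j)"
      using agree_mono U j(1) by blast
    then show ?thesis
      using agree_trans agree_sym j(2) s(1) by blast
  qed
  moreover have "controlled n tiled"
    unfolding controlled_def using tiled_cylindrical supervised_tiled by blast
  moreover have "tiled \<subseteq> X" by (auto simp: tiled_def)
  ultimately show ?thesis by blast
qed

lemma ex_controlled_chain:
  assumes "\<And>n. infinite (\<Delta> n)" "\<And>n. division_closed (\<Delta> n)" "\<And>n. finite (W n)"
  shows "\<exists>X F. \<forall>n. controlled n (X n) \<and> X (Suc n) \<subseteq> X n \<and> finite (F n) \<and> F n \<subseteq> \<Delta> n \<and>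
    (\<forall>x\<in>X (Suc n). \<forall>z\<in>X n. \<exists>s\<in>F n. agree (Suc n) (W n) (shift s x) z)"
proof -
  define Q where "Q n X X' \<longleftrightarrow> X' \<subseteq> X \<and> (\<exists>F. finite F \<and> F \<subseteq> \<Delta> n \<and>
    (\<forall>x\<in>X'. \<forall>z\<in>X. \<exists>s\<in>F. agree (Suc n) (W n) (shift s x) z))" for n X X'
  have "\<exists>X. \<forall>n. controlled n (X n) \<and> Q n (X n) (X (Suc n))"
  proof (rule dependent_nat_choice)
    show "\<exists>X. controlled 0 X"
      using cylindrical_colorings supervised_colorings unfolding controlled_def by blast
    show "\<exists>X'. controlled (Suc n) X' \<and> Q n X X'" if X: "controlled n X" for X n
    proof -
      have "controlled (Suc n) X"
        using X cylindrical_Suc supervised_Suc unfolding controlled_def by blast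
      then show ?thesis
        using controlled_step[OF _ assms(1,2,3)[of n]] unfolding Q_def by meson
    qed
  qed
  then obtain X where "\<And>n. controlled n (X n) \<and> Q n (X n) (X (Suc n))" by blast
  then show ?thesis
    unfolding Q_def by metis
qed

end

text \<open>Membership is decided by finitely many discrete coordinates, so the complement is a union of
open cylinders.\<close>

lemma closed_of_finitely_determined:
  fixes S :: "('a \<Rightarrow> nat \<Rightarrow> nat) set"
  assumes U: "finite U" and S: "\<And>x x'. agree m U x x' \<Longrightarrow> x \<in> S \<Longrightarrow> x' \<in> S"
  shows "closed S"
proof -
  have coord: "open {x :: 'a \<Rightarrow> nat \<Rightarrow> nat. x u i = v}" for u i v
  proof -
    have "continuous_on UNIV (\<lambda>x :: 'a \<Rightarrow> nat \<Rightarrow> nat. x u i)"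
      using continuous_on_product_then_coordinatewise[OF
          continuous_on_product_then_coordinatewise[OF continuous_on_id]] .
    then have "open ((\<lambda>x :: 'a \<Rightarrow> nat \<Rightarrow> nat. x u i) -` {v})"
      by (intro open_vimage open_discrete)
    then show ?thesis by (simp add: vimage_def)
  qed
  have nbhd: "open {x'. agree m U x x'}" for x :: "'a \<Rightarrow> nat \<Rightarrow> nat"
  proof -
    have "{x'. agree m U x x'} = (\<Inter>u\<in>U. \<Inter>i<m. {x'. x' u i = x u i})"
      by (auto simp: agree_def)
    then show ?thesis using U coord by (auto intro!: open_INT)
  qed
  have *: "open S'" if "\<And>x x'. agree m U x x' \<Longrightarrow> x \<in> S' \<Longrightarrow> x' \<in> S'" for S' :: "('a \<Rightarrow> nat \<Rightarrow> nat) set"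
  proof -
    have "S' = (\<Union>x\<in>S'. {x'. agree m U x x'})"
      using that by (auto simp: agree_def)
    then show ?thesis using nbhd by (metis open_UN)
  qed
  have "open (- S)" using *[of "- S"] S agree_sym by (metis Compl_iff)
  then show "closed S" by (simp add: closed_def)
qed

lemma compact_PiE_UNIV:
  assumes "compact (K :: 'c :: topological_space set)"
  shows "compact (PiE UNIV (\<lambda>_ :: 'b. K))"
proof -
  have "compactin (product_topology (\<lambda>_ :: 'b. euclidean) UNIV) (PiE UNIV (\<lambda>_. K))"
    using assms by (simp add: compactin_PiE)
  then show ?thesis
    unfolding euclidean_product_topology compactin_euclidean_iff .
qed

lemma compact_bounded_configs: "compact {x :: 'a \<Rightarrow> nat \<Rightarrow> nat. \<forall>g i. x g i < 3}"
proof -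
  have "compact (PiE (UNIV :: 'a set) (\<lambda>_. PiE UNIV (\<lambda>_ :: nat. {..<3 :: nat})))"
    by (intro compact_PiE_UNIV finite_imp_compact) simp
  also have "PiE (UNIV :: 'a set) (\<lambda>_. PiE UNIV (\<lambda>_ :: nat. {..<3 :: nat})) = {x. \<forall>g i. x g i < 3}"
    by (auto simp: PiE_iff)
  finally show ?thesis .
qed

context colored_group begin

lemma compact_colorings: "compact colorings"
proof -
  have "closed {x :: 'a config. x g i \<noteq> x (h i \<cdot> g) i}" for g i
    by (rule closed_of_finitely_determined[of "{g, h i \<cdot> g}" "Suc i"]) (auto simp: agree_def)
  then have "closed (\<Inter>g. \<Inter>i. {x :: 'a config. x g i \<noteq> x (h i \<cdot> g) i})"
    by blast
  moreover have "colorings = {x. \<forall>g i. x g i < 3} \<inter> (\<Inter>g. \<Inter>i. {x. x g i \<noteq> x (h i \<cdot> g) i})"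
    by (auto simp: colorings_def)
  ultimately show ?thesis
    by (simp add: compact_Int_closed compact_bounded_configs)
qed

text \<open>The sets \<open>X n\<close> of a controlled chain need not be closed. For this reason the limit is taken of the
closed conditions \<open>C n\<close> that hold on \<open>X (Suc n)\<close>: every window shows a pattern of \<open>X n\<close>,
and near every group element all patterns of \<open>X n\<close> are found by translations from the finite set \<open>F n\<close>.
Compactness gives a point that satisfies all of them.\<close>

theorem ex_minimal_colorings:
  assumes "\<And>n. infinite (\<Delta> n)" "\<And>n. division_closed (\<Delta> n)" "\<And>n. finite (W n)"
  shows "\<exists>Z\<subseteq>colorings. Z \<noteq> {} \<and> compact Z \<and> (\<forall>x\<in>Z. \<forall>g. shift g x \<in> Z) \<and>
    (\<forall>n. \<forall>x\<in>Z. \<forall>z\<in>Z. \<exists>s\<in>\<Delta> n. agree (Suc n) (W n) (shift s x) z)"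
proof -
  obtain X F where chain: "\<And>n. controlled n (X n)" "\<And>n. X (Suc n) \<subseteq> X n" "\<And>n. finite (F n)"
    "\<And>n. F n \<subseteq> \<Delta> n"
    "\<And>n x z. x \<in> X (Suc n) \<Longrightarrow> z \<in> X n \<Longrightarrow> \<exists>s\<in>F n. agree (Suc n) (W n) (shift s x) z"
    using ex_controlled_chain[of \<Delta> W, OF assms] by metis
  define C1 where "C1 n g = {x. \<exists>z\<in>X n. agree (Suc n) (W n) (shift g x) z}" for n g
  define C2 where "C2 n g z = {x. \<exists>s\<in>F n. agree (Suc n) (W n) (shift (s \<cdot> g) x) z}" for n g z
  define C where "C n = (\<Inter>g. C1 n g \<inter> (\<Inter>z\<in>X n. C2 n g z))" for n
  have local: "agree m V (shift g x) (shift g x')" if "agree m (translate V g) x x'" for m V g x x'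
    using that by (simp add: agree_shift_iff)
  have closed1: "closed (C1 n g)" for n g
  proof (rule closed_of_finitely_determined)
    show "finite (translate (W n) g)" using assms(3) by simp
    fix x x' assume a: "agree (Suc n) (translate (W n) g) x x'" "x \<in> C1 n g"
    then show "x' \<in> C1 n g"
      unfolding C1_def using agree_trans agree_sym local[OF a(1)] by blast
  qed
  have closed2: "closed (C2 n g z)" for n g z
  proof (rule closed_of_finitely_determined)
    show "finite (\<Union>s\<in>F n. translate (W n) (s \<cdot> g))" using assms(3) chain(3) by simp
    fix x x' assume a: "agree (Suc n) (\<Union>s\<in>F n. translate (W n) (s \<cdot> g)) x x'" "x \<in> C2 n g z"
    then obtain s where s: "s \<in> F n" "agree (Suc n) (W n) (shift (s \<cdot> g) x) z"
      unfolding C2_def by blast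
    have "agree (Suc n) (translate (W n) (s \<cdot> g)) x x'"
      using a(1) s(1) by (auto simp: agree_def)
    then have "agree (Suc n) (W n) (shift (s \<cdot> g) x') z"
      using agree_trans agree_sym local s(2) by blast
    then show "x' \<in> C2 n g z" using s(1) unfolding C2_def by blast
  qed
  have closedC: "closed (C n)" for n
    unfolding C_def using closed1 closed2 by (intro closed_INT ballI closed_Int) auto
  define K where "K n = colorings \<inter> (\<Inter>m<n. C m)" for n
  define Z where "Z = (\<Inter>n. K n)"
  have sub: "X n \<subseteq> X m" if "m \<le> n" for m n
    using lift_Suc_antimono_le[of X] chain(2) that by blast
  have inv: "shift g x \<in> X n" "x \<in> colorings" if "x \<in> X n" for g x n
    using chain(1)[of n] that unfolding controlled_def cylindrical_def by blast+
  have X_K: "X n \<subseteq> K n" for n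
  proof
    fix x assume x: "x \<in> X n"
    have "x \<in> C m" if m: "m < n" for m
      unfolding C_def
    proof (intro INT_I IntI)
      have x': "x \<in> X (Suc m)" using sub[of "Suc m" n] m x by auto
      show "x \<in> C1 m g" for g
      proof -
        have "shift g x \<in> X m" using inv(1)[OF x'] chain(2)[of m] by blast
        moreover have "agree (Suc m) (W m) (shift g x) (shift g x)" by (simp add: agree_def)
        ultimately show ?thesis unfolding C1_def by blast
      qed
      show "x \<in> C2 m g z" if "z \<in> X m" for g z
        unfolding C2_def using chain(5)[OF inv(1)[OF x'] that] by (simp add: shift_shift)
    qed
    then show "x \<in> K n" using inv(2)[OF x] by (auto simp: K_def)
  qed
  have Z_eq: "Z = colorings \<inter> (\<Inter>n. C n)"
    unfolding Z_def K_def by auto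
  have nonempty: "Z \<noteq> {}"
    unfolding Z_def
  proof (rule compact_space_imp_nest[of "top_of_set colorings"])
    show "compact_space (top_of_set colorings)"
      using compact_colorings by (simp add: compact_space_subtopology)
    show "closedin (top_of_set colorings) (K n)" for n
      unfolding K_def using closedC by (intro closedin_closed_Int closed_INT) auto
    show "K n \<noteq> {}" for n
      using X_K[of n] controlled_nonempty[OF chain(1)[of n]] by blast
    show "decseq K"
      unfolding K_def decseq_def by auto
  qed
  have compact: "compact Z"
    unfolding Z_eq using compact_colorings closedC by (intro compact_Int_closed closed_INT) auto
  have Z_sub: "Z \<subseteq> colorings" by (auto simp: Z_def K_def)
  have Z_C: "x \<in> C n" if "x \<in> Z" for x n
    using that by (auto simp: Z_def K_def)
  have invariant: "shift g x \<in> Z" if x: "x \<in> Z" for x g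
  proof -
    have "shift g x \<in> C1 n d \<longleftrightarrow> x \<in> C1 n (d \<cdot> g)"
      "shift g x \<in> C2 n d z \<longleftrightarrow> x \<in> C2 n (d \<cdot> g) z" for n d z
      by (simp_all add: C1_def C2_def shift_shift assoc)
    then have "shift g x \<in> C n" for n
      using Z_C[OF x, of n] by (simp add: C_def)
    moreover have "shift g x \<in> colorings"
      using x shift_colorings by (auto simp: Z_def K_def)
    ultimately show ?thesis by (auto simp: Z_def K_def)
  qed
  have dense: "\<exists>s\<in>\<Delta> n. agree (Suc n) (W n) (shift s x) z" if xz: "x \<in> Z" "z \<in> Z" for n x z
  proof -
    have "z \<in> C1 n neutral" using Z_C[OF xz(2), of n] by (auto simp: C_def)
    then obtain z0 where z0: "z0 \<in> X n" "agree (Suc n) (W n) z z0"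
      unfolding C1_def by auto
    have "x \<in> C2 n neutral z0" using Z_C[OF xz(1), of n] z0(1) by (auto simp: C_def)
    then obtain s where "s \<in> F n" "agree (Suc n) (W n) (shift s x) z0"
      unfolding C2_def by auto
    then show ?thesis
      using z0(2) agree_sym agree_trans chain(4)[of n] by blast
  qed
  show ?thesis
    using nonempty compact Z_sub invariant dense by (intro exI[of _ Z]) simp
qed

end

section \<open>From configurations to flows\<close>

lemma open_contains_initial_cylinder:
  fixes O' :: "(nat \<Rightarrow> nat) set"
  assumes "open O'" "f \<in> O'"
  shows "\<exists>m. \<forall>f'. (\<forall>k<m. f' k = f k) \<longrightarrow> f' \<in> O'"
proof -
  have "openin (product_topology (\<lambda>_. euclidean) UNIV) O'"
    using assms(1) by (simp add: euclidean_product_topology)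
  from product_topology_open_contains_basis[OF this assms(2)]
  obtain B where B: "f \<in> (\<Pi>\<^sub>E i\<in>UNIV. B i)" "finite {i. B i \<noteq> topspace (euclidean :: nat topology)}"
      "(\<Pi>\<^sub>E i\<in>UNIV. B i) \<subseteq> O'"
    by (elim exE conjE)
  have "finite {i. B i \<noteq> UNIV}" using B(2) by simp
  then obtain m where m: "\<And>i. B i \<noteq> UNIV \<Longrightarrow> i < m"
    unfolding finite_nat_set_iff_bounded by blast
  have "f' \<in> O'" if "\<forall>k<m. f' k = f k" for f'
  proof -
    have "f' i \<in> B i" for i
      using that m[of i] B(1) by (cases "B i = UNIV") (auto simp: PiE_iff)
    then have "f' \<in> (\<Pi>\<^sub>E i\<in>UNIV. B i)" by (simp add: PiE_iff)
    then show ?thesis using B(3) by blast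
  qed
  then show ?thesis by blast
qed

lemma Hausdorff_space_functions: "Hausdorff_space (euclidean :: (nat \<Rightarrow> nat) topology)"
proof -
  have "Hausdorff_space (euclidean :: nat topology)"
    unfolding Hausdorff_space_def disjnt_def by (simp add: separation_t2)
  then have "Hausdorff_space (product_topology (\<lambda>_ :: nat. euclidean :: nat topology) UNIV)"
    by (simp add: Hausdorff_space_product_topology)
  then show ?thesis
    by (simp add: euclidean_product_topology)
qed

definition flatten :: "nat config \<Rightarrow> nat \<Rightarrow> nat" where
  "flatten x k = x (fst (prod_decode k)) (snd (prod_decode k))"

definition unflatten :: "(nat \<Rightarrow> nat) \<Rightarrow> nat config" where
  "unflatten f g i = f (prod_encode (g, i))"

lemma unflatten_flatten [simp]: "unflatten (flatten x) = x"
  by (simp add: unflatten_def flatten_def fun_eq_iff)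

lemma flatten_unflatten [simp]: "flatten (unflatten f) = f"
  by (simp add: unflatten_def flatten_def fun_eq_iff)

lemma continuous_on_flatten: "continuous_on S flatten"
proof (rule continuous_on_coordinatewise_then_product)
  have "continuous_on S (\<lambda>x. x g i)" for g i and S :: "nat config set"
    using continuous_on_product_then_coordinatewise[OF
          continuous_on_product_then_coordinatewise[OF continuous_on_id]] .
  then show "continuous_on S (\<lambda>x. flatten x k)" for k
    unfolding flatten_def .
qed

text \<open>The shift acts by homeomorphisms on the flattened configurations, freely since each element
different from the identity is some \<open>h i\<close>. Density of an orbit only concerns finitely many
coordinates at a time, which is what the agreement on growing windows provides.\<close>

lemma flow_from_colorings:
  fixes G :: "('g, 'm) monoid_scheme"
  assumes G: "group G" and \<iota>: "bij_betw \<iota> (carrier G) (UNIV :: nat set)"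
    and \<iota>_mul: "\<And>a b. a \<in> carrier G \<Longrightarrow> b \<in> carrier G \<Longrightarrow> \<iota> (a \<otimes>\<^bsub>G\<^esub> b) = mul (\<iota> a) (\<iota> b)"
    and \<iota>_one: "\<iota> \<one>\<^bsub>G\<^esub> = neutral"
    and col: "colored_group mul neutral iv h"
    and h: "\<And>a. a \<noteq> neutral \<Longrightarrow> \<exists>i. h i = a"
    and Z: "Z \<subseteq> colored_group.colorings mul h" "Z \<noteq> {}" "compact Z"
      "\<And>x g. x \<in> Z \<Longrightarrow> enumerated_group.shift mul g x \<in> Z"
    and dense: "\<And>H m x z. H \<in> \<H> \<Longrightarrow> x \<in> Z \<Longrightarrow> z \<in> Z \<Longrightarrow>
      \<exists>n\<ge>m. \<exists>s\<in>H. agree (Suc n) {..n} (enumerated_group.shift mul (\<iota> s) x) z"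
    and \<H>: "\<And>H. H \<in> \<H> \<Longrightarrow> H \<subseteq> carrier G"
  shows "\<exists>(X :: (nat \<Rightarrow> nat) topology) \<phi>. free_flow G X \<phi> \<and> (\<forall>H\<in>\<H>. minimal_wrt H X \<phi>)"
proof -
  interpret G: Group.group G by (rule G)
  interpret colored_group mul neutral iv h by (rule col)
  define S where "S = flatten ` Z"
  define X where "X = top_of_set S"
  define act where "act g f = flatten (shift g (unflatten f))" for g f
  define \<phi> where "\<phi> g = restrict (act (\<iota> g)) S" for g
  have top: "topspace X = S" by (simp add: X_def)
  have act_S: "act g f \<in> S" if "f \<in> S" for g f
    using that Z(4) by (auto simp: S_def act_def)
  have act_act: "act a (act b f) = act (mul a b) f" for a b f
    by (simp add: act_def shift_shift)
  have act_neutral: "act neutral f = f" for f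
    by (simp add: act_def)
  have \<phi>_S: "\<phi> g f = act (\<iota> g) f" if "f \<in> S" for g f
    using that by (simp add: \<phi>_def)
  have bij: "bij_betw (act g) S S" for g
    by (rule bij_betw_byWitness[where f' = "act (iv g)"]) (auto simp: act_act act_neutral act_S)
  have \<phi>_Bij: "\<phi> g \<in> Bij S" for g
    using bij unfolding \<phi>_def Bij_def by (simp add: bij_betw_cong[of S _ "act (\<iota> g)"])
  have "group_action G (topspace X) \<phi>"
    unfolding group_action_def top
  proof (rule group_hom.intro[OF G group_BijGroup])
    show "group_hom_axioms G (BijGroup S) \<phi>"
    proof
      show "\<phi> \<in> hom G (BijGroup S)"
      proof (rule homI)
        show "\<phi> g \<in> carrier (BijGroup S)" for g
          using \<phi>_Bij by (simp add: BijGroup_def)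
        fix a b assume ab: "a \<in> carrier G" "b \<in> carrier G"
        have "\<phi> (a \<otimes>\<^bsub>G\<^esub> b) = compose S (\<phi> a) (\<phi> b)"
          using ab by (auto simp: \<phi>_def compose_def restrict_def fun_eq_iff \<iota>_mul act_act act_S)
        then show "\<phi> (a \<otimes>\<^bsub>G\<^esub> b) = \<phi> a \<otimes>\<^bsub>BijGroup S\<^esub> \<phi> b"
          using \<phi>_Bij by (simp add: BijGroup_def)
      qed
    qed
  qed
  moreover have "compact_space X"
    unfolding X_def
    by (rule compact_space_subtopology)
      (use compact_continuous_image[OF continuous_on_flatten Z(3)] in \<open>simp add: S_def\<close>)
  moreover have "Hausdorff_space X"
    unfolding X_def by (intro Hausdorff_space_subtopology Hausdorff_space_functions)
  moreover have "continuous_map (prod_topology (discrete_topology (carrier G)) X) X (\<lambda>(g, x). \<phi> g x)"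
  proof -
    have cont: "continuous_map X X (\<phi> g)" for g
    proof -
      have "continuous_on S (act (\<iota> g))"
      proof (rule continuous_on_coordinatewise_then_product)
        have "continuous_on S (\<lambda>f :: nat \<Rightarrow> nat. f k)" for k
          using continuous_on_product_then_coordinatewise[OF continuous_on_id] .
        then show "continuous_on S (\<lambda>f. act (\<iota> g) f k)" for k
          unfolding act_def flatten_def unflatten_def shift_def .
      qed
      then have "continuous_on S (\<phi> g)"
        by (simp add: \<phi>_def)
      moreover have "\<phi> g ` S \<subseteq> S" using act_S by (auto simp: \<phi>_S)
      ultimately show ?thesis
        by (auto simp: X_def continuous_map_in_subtopology)
    qed
    show ?thesis
      unfolding continuous_map_def
    proof (intro conjI allI impI)
      show "(\<lambda>(g, x). \<phi> g x) \<in> topspace (prod_topology (discrete_topology (carrier G)) X) \<rightarrow> topspace X"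
        using act_S by (auto simp: top \<phi>_S)
      fix V assume V: "openin X V"
      let ?P = "prod_topology (discrete_topology (carrier G)) X"
      have "{z \<in> topspace ?P. (\<lambda>(g, x). \<phi> g x) z \<in> V}
          = (\<Union>g\<in>carrier G. {g} \<times> {x \<in> topspace X. \<phi> g x \<in> V})"
        by auto
      also have "openin ?P \<dots>"
      proof (intro openin_Union ballI, clarify)
        fix g assume "g \<in> carrier G"
        then show "openin ?P ({g} \<times> {x \<in> topspace X. \<phi> g x \<in> V})"
          using openin_continuous_map_preimage[OF cont V] by (simp add: openin_prod_Times_iff)
      qed
      finally show "openin ?P {z \<in> topspace ?P. (\<lambda>(g, x). \<phi> g x) z \<in> V}" .
    qed
  qed
  ultimately have "flow G X \<phi>"
    using Z(2) by (simp add: flow_def top S_def)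
  moreover have "\<phi> g f \<noteq> f" if f: "f \<in> S" and g: "g \<in> carrier G" "g \<noteq> \<one>\<^bsub>G\<^esub>" for f g
  proof
    assume fix_pt: "\<phi> g f = f"
    define x where "x = unflatten f"
    have "x \<in> colorings" using f Z(1) by (auto simp: x_def S_def)
    have "\<iota> g \<noteq> neutral"
      using g \<iota> \<iota>_one by (metis G.one_closed bij_betw_imp_inj_on inj_onD)
    then obtain i where i: "h i = \<iota> g" using h by blast
    have "unflatten (flatten (shift (\<iota> g) x)) = unflatten f"
      using fix_pt f by (simp add: \<phi>_S act_def x_def)
    then have "shift (\<iota> g) x = x" by (simp add: x_def)
    then have "x (mul neutral (\<iota> g)) i = x neutral i"
      by (metis shift_def)
    then have "x (mul (h i) neutral) i = x neutral i" by (simp add: i)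
    then show False using \<open>x \<in> colorings\<close> unfolding colorings_def by (metis (mono_tags, lifting) mem_Collect_eq)
  qed
  ultimately have "free_flow G X \<phi>"
    by (simp add: free_flow_def top)
  moreover have "minimal_wrt H X \<phi>" if H: "H \<in> \<H>" for H
    unfolding minimal_wrt_def top
  proof (intro ballI antisym)
    fix f assume f: "f \<in> S"
    show "X closure_of {\<phi> s f |s. s \<in> H} \<subseteq> S"
      using closure_of_subset_topspace[of X] by (simp add: top)
    show "S \<subseteq> X closure_of {\<phi> s f |s. s \<in> H}"
    proof
      fix f' assume f': "f' \<in> S"
      have "\<exists>w\<in>{\<phi> s f |s. s \<in> H}. w \<in> V" if V: "openin X V" "f' \<in> V" for V
      proof -
        obtain O' where O': "open O'" "V = O' \<inter> S"
          using V(1) by (auto simp: X_def openin_open Int_commute)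
        obtain m where m: "\<And>w. (\<forall>k<m. w k = f' k) \<Longrightarrow> w \<in> O'"
          using open_contains_initial_cylinder[OF O'(1)] V(2) O'(2) by blast
        have "unflatten f \<in> Z" "unflatten f' \<in> Z" using f f' by (auto simp: S_def)
        then obtain n s where n: "m \<le> n" "s \<in> H"
            "agree (Suc n) {..n} (shift (\<iota> s) (unflatten f)) (unflatten f')"
          using dense[OF H] by blast
        have "\<phi> s f k = f' k" if "k < m" for k
        proof -
          have k: "prod_encode (fst (prod_decode k), snd (prod_decode k)) = k" by simp
          then have "fst (prod_decode k) \<le> n" "snd (prod_decode k) < Suc n"
            using le_prod_encode_1 le_prod_encode_2 that n(1)
            by (metis le_trans less_imp_le_nat less_Suc_eq_le)+
          then have "shift (\<iota> s) (unflatten f) (fst (prod_decode k)) (snd (prod_decode k))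
              = unflatten f' (fst (prod_decode k)) (snd (prod_decode k))"
            using n(3) by (simp add: agree_def)
          then have "flatten (shift (\<iota> s) (unflatten f)) k = flatten (unflatten f') k"
            by (simp only: flatten_def)
          then show ?thesis using f by (simp add: \<phi>_S act_def)
        qed
        then have "\<phi> s f \<in> O'" using m by blast
        moreover have "\<phi> s f \<in> S" using act_S f by (simp add: \<phi>_S)
        ultimately show ?thesis using n(2) O'(2) by blast
      qed
      then show "f' \<in> X closure_of {\<phi> s f |s. s \<in> H}"
        using f' by (auto simp: in_closure_of top)
    qed
  qed
  ultimately show ?thesis by blast
qed

lemma minimal_wrt_mono:
  assumes "minimal_wrt H X \<phi>" "H \<subseteq> H'"
  shows "minimal_wrt H' X \<phi>"
  unfolding minimal_wrt_def
proof (intro ballI antisym)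
  fix x assume "x \<in> topspace X"
  then have "topspace X = X closure_of {\<phi> s x |s. s \<in> H}"
    using assms(1) by (simp add: minimal_wrt_def)
  also have "\<dots> \<subseteq> X closure_of {\<phi> s x |s. s \<in> H'}"
    using assms(2) by (intro closure_of_mono) blast
  finally show "topspace X \<subseteq> X closure_of {\<phi> s x |s. s \<in> H'}" .
qed (rule closure_of_subset_topspace)

text \<open>The group is transported to the type of natural numbers, and the subgroups are enumerated such
that each one is treated for infinitely many of the windows \<open>{..n}\<close>. Adding the whole group to
the family ensures that there is a subgroup to enumerate.\<close>

theorem ex_free_flow_minimal_wrt_countably_many:
  fixes G :: "('g, 'm) monoid_scheme"
  assumes "group G" and "countable (carrier G)" and "infinite (carrier G)"
    and "countable \<H>" and \<H>: "\<And>H. H \<in> \<H> \<Longrightarrow> subgroup H G \<and> infinite H"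
  shows "\<exists>(X :: (nat \<Rightarrow> nat) topology) \<phi>. free_flow G X \<phi> \<and> (\<forall>H\<in>\<H>. minimal_wrt H X \<phi>)"
proof -
  interpret G: Group.group G by fact
  define \<K> where "\<K> = insert (carrier G) \<H>"
  have \<K>: "subgroup H G" "infinite H" if "H \<in> \<K>" for H
    using that \<H> assms(3) G.subgroup_self by (auto simp: \<K>_def)
  have "countable \<K>" "\<K> \<noteq> {}" using assms(4) by (auto simp: \<K>_def)
  define \<iota> where "\<iota> = to_nat_on (carrier G)"
  define \<kappa> where "\<kappa> = from_nat_into (carrier G)"
  have \<iota>: "bij_betw \<iota> (carrier G) UNIV"
    unfolding \<iota>_def using assms(2,3) by (rule to_nat_on_infinite)
  have \<kappa>_in: "\<kappa> k \<in> carrier G" for k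
    unfolding \<kappa>_def using from_nat_into[of "carrier G"] assms(3) by auto
  have \<iota>\<kappa> [simp]: "\<iota> (\<kappa> k) = k" for k
    unfolding \<iota>_def \<kappa>_def using assms(2,3) by simp
  have \<kappa>\<iota> [simp]: "\<kappa> (\<iota> g) = g" if "g \<in> carrier G" for g
    unfolding \<iota>_def \<kappa>_def using assms(2) that by simp
  define mul where "mul a b = \<iota> (\<kappa> a \<otimes>\<^bsub>G\<^esub> \<kappa> b)" for a b
  define neutral where "neutral = \<iota> \<one>\<^bsub>G\<^esub>"
  define iv where "iv a = \<iota> (inv\<^bsub>G\<^esub> \<kappa> a)" for a
  define h where "h i = (if i = neutral then Suc neutral else i)" for i
  interpret N: colored_group mul neutral iv h
    by unfold_locales
      (auto simp: mul_def neutral_def iv_def h_def \<kappa>_in G.m_assoc)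
  define \<Delta> where "\<Delta> n = \<iota> ` from_nat_into \<K> (fst (prod_decode n))" for n
  have in_\<K>: "from_nat_into \<K> k \<in> \<K>" for k
    using from_nat_into[OF \<open>\<K> \<noteq> {}\<close>] .
  have inf: "infinite (\<Delta> n)" for n
  proof -
    have "inj_on \<iota> (from_nat_into \<K> (fst (prod_decode n)))"
      using \<iota> G.subgroupE(1)[OF \<K>(1)[OF in_\<K>]] by (metis bij_betw_imp_inj_on inj_on_subset)
    then show ?thesis
      using \<K>(2)[OF in_\<K>] by (simp add: \<Delta>_def finite_image_iff)
  qed
  have div: "N.division_closed (\<Delta> n)" for n
    unfolding N.division_closed_def
  proof (intro ballI)
    define H where "H = from_nat_into \<K> (fst (prod_decode n))"
    have H: "subgroup H G" using \<K>(1)[OF in_\<K>] by (simp add: H_def)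
    fix a b c assume "a \<in> \<Delta> n" "b \<in> \<Delta> n" "c \<in> \<Delta> n"
    then obtain a' b' c' where abc: "a' \<in> H" "b' \<in> H" "c' \<in> H" "a = \<iota> a'" "b = \<iota> b'" "c = \<iota> c'"
      by (auto simp: \<Delta>_def H_def)
    have carr: "a' \<in> carrier G" "b' \<in> carrier G" "c' \<in> carrier G"
      using abc G.subgroupE(1)[OF H] by auto
    then have "mul (mul a (iv b)) c = \<iota> (a' \<otimes>\<^bsub>G\<^esub> inv\<^bsub>G\<^esub> b' \<otimes>\<^bsub>G\<^esub> c')"
      by (simp add: mul_def iv_def abc)
    also have "\<dots> \<in> \<iota> ` H"
      using abc H by (intro imageI) (simp add: G.subgroupE)
    finally show "mul (mul a (iv b)) c \<in> \<Delta> n" by (simp add: \<Delta>_def H_def)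
  qed
  obtain Z where Z: "Z \<subseteq> N.colorings" "Z \<noteq> {}" "compact Z" "\<And>x g. x \<in> Z \<Longrightarrow> N.shift g x \<in> Z"
    and dense: "\<And>n x z. x \<in> Z \<Longrightarrow> z \<in> Z \<Longrightarrow> \<exists>s\<in>\<Delta> n. agree (Suc n) {..n} (N.shift s x) z"
    using N.ex_minimal_colorings[of \<Delta> "\<lambda>n. {..n}"] inf div by (metis finite_atMost)
  show ?thesis
  proof (rule flow_from_colorings[OF assms(1) \<iota>, of mul neutral iv h Z \<H>])
    show "\<iota> (a \<otimes>\<^bsub>G\<^esub> b) = mul (\<iota> a) (\<iota> b)" if "a \<in> carrier G" "b \<in> carrier G" for a b
      using that by (simp add: mul_def)
    show "\<iota> \<one>\<^bsub>G\<^esub> = neutral" by (simp add: neutral_def)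
    show "colored_group mul neutral iv h" by (rule N.colored_group_axioms)
    show "\<exists>i. h i = a" if "a \<noteq> neutral" for a
      using that by (intro exI[of _ a]) (simp add: h_def)
    show "H \<subseteq> carrier G" if "H \<in> \<H>" for H
      using \<H> that G.subgroupE(1) by blast
    fix H m x z assume H: "H \<in> \<H>" and xz: "x \<in> Z" "z \<in> Z"
    have "H \<in> \<K>" using H by (simp add: \<K>_def)
    then obtain k where k: "from_nat_into \<K> k = H"
      using from_nat_into_surj[OF \<open>countable \<K>\<close>] by blast
    define n where "n = prod_encode (k, m)"
    have "\<Delta> n = \<iota> ` H" by (simp add: \<Delta>_def n_def k)
    then show "\<exists>n\<ge>m. \<exists>s\<in>H. agree (Suc n) {..n} (N.shift (\<iota> s) x) z"
      using dense[OF xz, of n] le_prod_encode_2[of m k] unfolding n_def by auto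
  qed (use Z in auto)
qed

text \<open>An infinite subgroup that is not locally finite contains an infinite finitely generated one. There
are only countably many of the latter, and minimality is inherited by larger subgroups.\<close>

theorem corollary1p5:
  fixes G :: "('g, 'm) monoid_scheme"
  assumes "group G"
    and "countable (carrier G)" and "infinite (carrier G)"
    and "countable {H. subgroup H G \<and> infinite H \<and> locally_finite_group (G\<lparr>carrier := H\<rparr>)}"
  shows "\<exists>(X :: (nat \<Rightarrow> nat) topology) \<phi>.
           free_flow G X \<phi> \<and>
           (\<forall>H. subgroup H G \<and> infinite H \<longrightarrow> minimal_wrt H X \<phi>)"
proof -
  interpret G: Group.group G by fact
  define \<L> where "\<L> = {H. subgroup H G \<and> infinite H \<and> locally_finite_group (G\<lparr>carrier := H\<rparr>)}"
  define \<F> where "\<F> = generate G ` {A. finite A \<and> A \<subseteq> carrier G}"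
  define \<H> where "\<H> = {H \<in> \<L> \<union> \<F>. subgroup H G \<and> infinite H}"
  have "countable \<F>"
    unfolding \<F>_def using countable_Collect_finite_subset[OF assms(2)] by (intro countable_image) simp
  then have "countable \<H>"
    unfolding \<H>_def using assms(4) by (intro countable_Collect) (simp add: \<L>_def)
  have "\<exists>(X :: (nat \<Rightarrow> nat) topology) \<phi>. free_flow G X \<phi> \<and> (\<forall>H\<in>\<H>. minimal_wrt H X \<phi>)"
    by (rule ex_free_flow_minimal_wrt_countably_many[OF assms(1-3) \<open>countable \<H>\<close>])
      (simp add: \<H>_def)
  then obtain X :: "(nat \<Rightarrow> nat) topology" and \<phi>
    where X: "free_flow G X \<phi>" and min: "\<forall>H\<in>\<H>. minimal_wrt H X \<phi>"
    by (elim exE conjE)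
  have "minimal_wrt H X \<phi>" if H: "subgroup H G" "infinite H" for H
  proof (cases "locally_finite_group (G\<lparr>carrier := H\<rparr>)")
    case True
    then show ?thesis using min H by (auto simp: \<H>_def \<L>_def)
  next
    case False
    then obtain A where A: "A \<subseteq> H" "finite A" "infinite (generate G A)"
      unfolding locally_finite_group_def using G.generate_consistent[OF _ H(1)] by auto
    have AG: "A \<subseteq> carrier G" using A(1) G.subgroupE(1)[OF H(1)] by blast
    then have "generate G A \<in> \<H>"
      using A(2,3) G.generate_is_subgroup[OF AG] by (auto simp: \<H>_def \<F>_def)
    then have "minimal_wrt (generate G A) X \<phi>" using min by blast
    then show ?thesis
      by (rule minimal_wrt_mono) (rule G.generate_subgroup_incl[OF A(1) H(1)])
  qed
  then show ?thesis
    using X by (intro exI[of _ X] exI[of _ \<phi>]) simp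
qed

end
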